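(* Let $A_s=(\mathbb{Z}_{I_s},\otimes)$, $s\in S$, be a family of torsion-free fusion rings. Then their free product $A=*_{s\in S}A_s$ is again torsion-free.
   Context: Fusion rings. Let $I$ be a set with distinguished element $\mathbb{1}$ and an involution $\alpha\mapsto\overline{\alpha}$ fixing $\mathbb{1}$. Let $\mathbb{Z}_I$ be the free abelian group with basis $I$, extend the involution $\mathbb{Z}$-linearly, and let $\tau:\mathbb{Z}_I\to\mathbb{Z}$ be the $\mathbb{Z}$-linear functional with $\tau(\alpha)=\delta_{\alpha,\mathbb{1}}$ for $\alpha\in I$. An $I$-based ring is a ring structure $\otimes$ on the abelian group $\mathbb{Z}_I$ with unit $\mathbb{1}$ such that for all $\alpha,\beta,\gamma\in I$: $\overline{\alpha\otimes\beta}=\overline{\beta}\otimes\overline{\alpha}$; $\tau(\overline{\alpha}\otimes\beta)=\delta_{\alpha,\beta}$; $\tau(\alpha\otimes\beta\otimes\gamma)\in\mathbb{N}=\{0,1,2,\dots\}$. Write $\alpha\otimes\beta=\sum_\gamma N_{\alpha\beta}^\gamma\gamma$ with $N_{\alpha\beta}^\gamma=\tau(\alpha\otimes\beta\otimes\overline{\gamma})$. A fusion ring is a based ring admitting a dimension function, i.e. a unital ring homomorphism $d:(\mathbb{Z}_I,\otimes)\to\mathbb{R}$ with $d(\alpha)>0$ and $d(\alpha)=d(\overline{\alpha})$ for all $\alpha\in I$. Free product. For fusion rings $(\mathbb{Z}_{I_s},\otimes)$ with units $\mathbb{1}_s$, $s\in S$, let $I=*_sI_s$ be the set of alternating words (possibly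 empty) with letters in $\bigsqcup_s(I_s\setminus\{\mathbb{1}_s\})$, i.e. consecutive letters belong to different $I_s$. Its distinguished element $\mathbb{1}$ is the empty word, and its involution reverses words and applies the involution of $I_s$ to each letter. The free product is the unique $I$-based ring with unit $\mathbb{1}$ such that, for alternating words $w\alpha$ and $\beta z$ with last letter $\alpha\in I_s\setminus\{\mathbb{1}_s\}$ and first letter $\beta\in I_t\setminus\{\mathbb{1}_t\}$: if $s\ne t$ then $w\alpha\otimes\beta z=w\alpha\beta z$; if $s=t$ then $w\alpha\otimes\beta z=N_{\alpha\beta}^{\mathbb{1}_s}(w\otimes z)+\sum_{\gamma\in I_s\setminus\{\mathbb{1}_s\}}N_{\alpha\beta}^\gamma\,w\gamma z$. It is a fusion ring, with dimension function determined by restricting to the given dimension functions $d_s$ on the letters. Cofinite based modules. Let $J$ be a set. A cofinite ($J$-)based module for $(\mathbb{Z}_I,\otimes)$ is a unital left $(\mathbb{Z}_I,\otimes)$-module structure $\otimes$ on $\mathbb{Z}_J$ together with a $\mathbb{Z}_I$-valued bilinear form $\langle\cdot,\cdot\rangle$ on $\mathbb{Z}_J$ such that for all $\alpha\in I$, $b,c\in J$: $\langle\alpha\otimes b,c\rangle=\alpha\otimes\langle b,c\rangle$; $\langle b,c\rangle=\overline{\langle c,b\rangle}$; $\tau(\langle b,c\rangle)=\delta_{b,c}$; $\tau(\alpha\otimes\langle b,c\rangle)\in\mathbb{N}$. Put $N_{\alpha b}^c=\tau(\alpha\otimes\langle b,c\rangle)$; then $\alpha\otimes b=\sum_{c}N_{\alpha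 b}^c\,c$. The module is connected if for all $b,c\in J$ there is $\alpha\in I$ with $N_{\alpha b}^c\neq0$. The standard based module is $\mathbb{Z}_I$ itself (basis $I$) with left multiplication and $\langle\alpha,\beta\rangle=\alpha\otimes\overline{\beta}$. Isomorphisms of based modules are module isomorphisms taking basis elements to basis elements. A fusion ring is torsion-free if every non-zero connected cofinite based module over it is isomorphic to the standard based module. *)

theory Defs
  imports
    Complex_Main
    "HOL-Algebra.Module"
    "HOL-Algebra.Free_Abelian_Groups"
begin

section \<open>Based rings and fusion rings\<close>

text \<open>
  The free abelian group on a set \<open>I :: 'i set\<close> is the library's \<^const>\<open>free_Abelian_group\<close>: its elements
  are the \<open>x :: 'i \<Rightarrow>\<^sub>0 int\<close> with \<open>Poly_Mapping.keys x \<subseteq> I\<close>, the basis element given by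
  \<open>i\<close> is \<open>frag_of i\<close>, and \<^const>\<open>frag_extend\<close> is the linear extension of a map given on basis elements.
\<close>

record 'i based_ring_data = "('i \<Rightarrow>\<^sub>0 int) ring" +
  basis :: "'i set"
  unit_index :: 'i
  conj_index :: "'i \<Rightarrow> 'i"

definition bar :: "('i, 'm) based_ring_data_scheme \<Rightarrow> ('i \<Rightarrow>\<^sub>0 int) \<Rightarrow> ('i \<Rightarrow>\<^sub>0 int)"
  where "bar R = frag_extend (frag_of \<circ> conj_index R)"

definition tau :: "('i, 'm) based_ring_data_scheme \<Rightarrow> ('i \<Rightarrow>\<^sub>0 int) \<Rightarrow> int"
  where "tau R x = Poly_Mapping.lookup x (unit_index R)"

locale based_ring = ring R for R :: "('i, 'm) based_ring_data_scheme" (structure) +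
  assumes carrier_eq: "carrier R = carrier (free_Abelian_group (basis R))"
    and zero_eq: "\<zero> = 0"
    and add_eq: "add R = (+)"
    and unit_index_in_basis: "unit_index R \<in> basis R"
    and conj_index_in_basis: "a \<in> basis R \<Longrightarrow> conj_index R a \<in> basis R"
    and conj_index_conj_index: "a \<in> basis R \<Longrightarrow> conj_index R (conj_index R a) = a"
    and conj_index_unit: "conj_index R (unit_index R) = unit_index R"
    and one_eq: "\<one> = frag_of (unit_index R)"
    and bar_mult: "\<lbrakk>a \<in> basis R; b \<in> basis R\<rbrakk> \<Longrightarrow>
      bar R (frag_of a \<otimes> frag_of b) = bar R (frag_of b) \<otimes> bar R (frag_of a)"
    and tau_bar_mult: "\<lbrakk>a \<in> basis R; b \<in> basis R\<rbrakk> \<Longrightarrow>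
      tau R (bar R (frag_of a) \<otimes> frag_of b) = (if a = b then 1 else 0)"
    and tau_mult_nonneg: "\<lbrakk>a \<in> basis R; b \<in> basis R; c \<in> basis R\<rbrakk> \<Longrightarrow>
      0 \<le> tau R (frag_of a \<otimes> frag_of b \<otimes> frag_of c)"

definition struct_const :: "('i, 'm) based_ring_data_scheme \<Rightarrow> 'i \<Rightarrow> 'i \<Rightarrow> 'i \<Rightarrow> int"
  where "struct_const R a b c = tau R (frag_of a \<otimes>\<^bsub>R\<^esub> frag_of b \<otimes>\<^bsub>R\<^esub> bar R (frag_of c))"

lemma tau_diff: "tau R (x - y) = tau R x - tau R y"
  by (simp add: tau_def lookup_minus)

context based_ring
begin

lemma frag_of_closed: "a \<in> basis R \<Longrightarrow> frag_of a \<in> carrier R"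
  by (simp add: carrier_eq free_Abelian_group_def)

lemma minus_closed': "\<lbrakk>x \<in> carrier R; y \<in> carrier R\<rbrakk> \<Longrightarrow> x - y \<in> carrier R"
  unfolding carrier_eq free_Abelian_group_def using keys_diff[of x y] by auto

lemma mult_diff_left:
  assumes "x \<in> carrier R" "y \<in> carrier R" "z \<in> carrier R"
  shows "(x - y) \<otimes> z = x \<otimes> z - y \<otimes> z"
proof -
  have "(x - y \<oplus> y) \<otimes> z = (x - y) \<otimes> z \<oplus> y \<otimes> z"
    using assms minus_closed' by (intro l_distr) auto
  then show ?thesis by (simp add: add_eq algebra_simps)
qed

lemma mult_diff_right:
  assumes "x \<in> carrier R" "y \<in> carrier R" "z \<in> carrier R"
  shows "z \<otimes> (x - y) = z \<otimes> x - z \<otimes> y"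
proof -
  have "z \<otimes> (x - y \<oplus> y) = z \<otimes> (x - y) \<oplus> z \<otimes> y"
    using assms minus_closed' by (intro r_distr) auto
  then show ?thesis by (simp add: add_eq algebra_simps)
qed

lemma tau_mult_bar:
  assumes "x \<in> carrier R" and c: "c \<in> basis R"
  shows "tau R (x \<otimes> bar R (frag_of c)) = Poly_Mapping.lookup x c"
proof -
  have barc: "bar R (frag_of c) \<in> carrier R"
    using c by (simp add: bar_def frag_of_closed conj_index_in_basis)
  have "Poly_Mapping.keys x \<subseteq> basis R"
    using assms(1) by (simp add: carrier_eq free_Abelian_group_def)
  then have "x \<in> carrier R \<and> tau R (x \<otimes> bar R (frag_of c)) = Poly_Mapping.lookup x c"
  proof (induction rule: frag_induction)
    case zero
    have "\<zero> \<otimes> bar R (frag_of c) = \<zero>" using barc by (rule l_null)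
    then show ?case using zero_closed by (simp add: tau_def zero_eq)
  next
    case (one a)
    have "frag_of a = bar R (frag_of (conj_index R a))"
      using one by (simp add: bar_def conj_index_conj_index)
    then have "tau R (frag_of a \<otimes> bar R (frag_of c)) = (if conj_index R a = conj_index R c then 1 else 0)"
      using tau_bar_mult[of "conj_index R a" "conj_index R c"] one c
      by (simp add: bar_def conj_index_in_basis)
    also have "\<dots> = (if c = a then 1 else 0)"
      using one c by (metis conj_index_conj_index)
    finally show ?case using one by (simp add: frag_of_closed)
  next
    case (diff x y)
    then show ?case
      using barc by (simp add: mult_diff_left minus_closed' tau_diff lookup_minus)
  qed
  then show ?thesis by simp
qed

lemma struct_const_lookup:
  assumes "a \<in> basis R" "b \<in> basis R" "c \<in> basis R"
  shows "struct_const R a b c = Poly_Mapping.lookup (frag_of a \<otimes> frag_of b) c"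
  unfolding struct_const_def using assms by (intro tau_mult_bar m_closed frag_of_closed)

lemma finite_struct_const:
  assumes "a \<in> basis R" "b \<in> basis R"
  shows "finite {c \<in> basis R. struct_const R a b c \<noteq> 0}"
proof (rule finite_subset)
  show "{c \<in> basis R. struct_const R a b c \<noteq> 0} \<subseteq> Poly_Mapping.keys (frag_of a \<otimes> frag_of b)"
    using assms by (auto simp: struct_const_lookup in_keys_iff)
qed simp

end

definition real_ring :: "real ring"
  where "real_ring = \<lparr>carrier = UNIV, monoid.mult = (*), one = 1, ring.zero = 0, add = (+)\<rparr>"

definition dimension_function ::
    "('i, 'm) based_ring_data_scheme \<Rightarrow> (('i \<Rightarrow>\<^sub>0 int) \<Rightarrow> real) \<Rightarrow> bool"
  where "dimension_function R d \<longleftrightarrow>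
    d \<in> ring_hom R real_ring \<and>
    (\<forall>a\<in>basis R. d (frag_of a) > 0 \<and> d (frag_of a) = d (bar R (frag_of a)))"

locale fusion_ring = based_ring +
  assumes ex_dimension_function: "\<exists>d. dimension_function R d"


section \<open>Cofinite based modules and torsion-freeness\<close>

text \<open>The library locale \<^locale>\<open>module\<close> is restricted to commutative rings.\<close>

locale left_module = R?: ring R + M?: abelian_group M for R (structure) and M (structure) +
  assumes smult_closed: "\<lbrakk>a \<in> carrier R; x \<in> carrier M\<rbrakk> \<Longrightarrow> a \<odot>\<^bsub>M\<^esub> x \<in> carrier M"
    and smult_l_distr: "\<lbrakk>a \<in> carrier R; b \<in> carrier R; x \<in> carrier M\<rbrakk> \<Longrightarrow>
      (a \<oplus>\<^bsub>R\<^esub> b) \<odot>\<^bsub>M\<^esub> x = a \<odot>\<^bsub>M\<^esub> x \<oplus>\<^bsub>M\<^esub> b \<odot>\<^bsub>M\<^esub> x"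
    and smult_r_distr: "\<lbrakk>a \<in> carrier R; x \<in> carrier M; y \<in> carrier M\<rbrakk> \<Longrightarrow>
      a \<odot>\<^bsub>M\<^esub> (x \<oplus>\<^bsub>M\<^esub> y) = a \<odot>\<^bsub>M\<^esub> x \<oplus>\<^bsub>M\<^esub> a \<odot>\<^bsub>M\<^esub> y"
    and smult_assoc: "\<lbrakk>a \<in> carrier R; b \<in> carrier R; x \<in> carrier M\<rbrakk> \<Longrightarrow>
      (a \<otimes>\<^bsub>R\<^esub> b) \<odot>\<^bsub>M\<^esub> x = a \<odot>\<^bsub>M\<^esub> (b \<odot>\<^bsub>M\<^esub> x)"
    and smult_one: "x \<in> carrier M \<Longrightarrow> \<one>\<^bsub>R\<^esub> \<odot>\<^bsub>M\<^esub> x = x"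

text \<open>As in the library record \<^typ>\<open>('a, 'b) module\<close>, the fields \<open>mult\<close> and \<open>one\<close> of a module are never used.\<close>

record ('i, 'j) based_module_data = "('i \<Rightarrow>\<^sub>0 int, 'j \<Rightarrow>\<^sub>0 int) module" +
  module_basis :: "'j set"
  form :: "('j \<Rightarrow>\<^sub>0 int) \<Rightarrow> ('j \<Rightarrow>\<^sub>0 int) \<Rightarrow> ('i \<Rightarrow>\<^sub>0 int)"

locale cofinite_based_module = based_ring R + left_module R M
  for R :: "('i, 'm) based_ring_data_scheme" (structure)
    and M :: "('i, 'j, 'n) based_module_data_scheme" +
  assumes module_carrier_eq: "carrier M = carrier (free_Abelian_group (module_basis M))"
    and module_zero_eq: "\<zero>\<^bsub>M\<^esub> = 0"
    and module_add_eq: "add M = (+)"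
    and form_closed: "\<lbrakk>x \<in> carrier M; y \<in> carrier M\<rbrakk> \<Longrightarrow> form M x y \<in> carrier R"
    and form_add_left: "\<lbrakk>x \<in> carrier M; y \<in> carrier M; z \<in> carrier M\<rbrakk> \<Longrightarrow>
      form M (x \<oplus>\<^bsub>M\<^esub> y) z = form M x z \<oplus> form M y z"
    and form_add_right: "\<lbrakk>x \<in> carrier M; y \<in> carrier M; z \<in> carrier M\<rbrakk> \<Longrightarrow>
      form M x (y \<oplus>\<^bsub>M\<^esub> z) = form M x y \<oplus> form M x z"
    and form_smult: "\<lbrakk>a \<in> basis R; b \<in> module_basis M; c \<in> module_basis M\<rbrakk> \<Longrightarrow>
      form M (frag_of a \<odot>\<^bsub>M\<^esub> frag_of b) (frag_of c) = frag_of a \<otimes> form M (frag_of b) (frag_of c)"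
    and form_bar: "\<lbrakk>b \<in> module_basis M; c \<in> module_basis M\<rbrakk> \<Longrightarrow>
      form M (frag_of b) (frag_of c) = bar R (form M (frag_of c) (frag_of b))"
    and tau_form: "\<lbrakk>b \<in> module_basis M; c \<in> module_basis M\<rbrakk> \<Longrightarrow>
      tau R (form M (frag_of b) (frag_of c)) = (if b = c then 1 else 0)"
    and tau_mult_form_nonneg: "\<lbrakk>a \<in> basis R; b \<in> module_basis M; c \<in> module_basis M\<rbrakk> \<Longrightarrow>
      0 \<le> tau R (frag_of a \<otimes> form M (frag_of b) (frag_of c))"

definition module_const ::
    "('i, 'm) based_ring_data_scheme \<Rightarrow> ('i, 'j, 'n) based_module_data_scheme \<Rightarrow> 'i \<Rightarrow> 'j \<Rightarrow> 'j \<Rightarrow> int"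
  where "module_const R M a b c = tau R (frag_of a \<otimes>\<^bsub>R\<^esub> form M (frag_of b) (frag_of c))"

definition connected_module ::
    "('i, 'm) based_ring_data_scheme \<Rightarrow> ('i, 'j, 'n) based_module_data_scheme \<Rightarrow> bool"
  where "connected_module R M \<longleftrightarrow>
    (\<forall>b\<in>module_basis M. \<forall>c\<in>module_basis M. \<exists>a\<in>basis R. module_const R M a b c \<noteq> 0)"

definition standard_module :: "('i, 'm) based_ring_data_scheme \<Rightarrow> ('i, 'i) based_module_data"
  where "standard_module R =
    \<lparr>carrier = carrier R, monoid.mult = mult R, one = one R, ring.zero = \<zero>\<^bsub>R\<^esub>, add = add R,
     smult = mult R, module_basis = basis R, form = (\<lambda>x y. x \<otimes>\<^bsub>R\<^esub> bar R y)\<rparr>"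

definition based_module_iso ::
    "('i, 'm) based_ring_data_scheme \<Rightarrow> ('i, 'j, 'n) based_module_data_scheme \<Rightarrow>
     ('i, 'k, 'l) based_module_data_scheme \<Rightarrow> (('j \<Rightarrow>\<^sub>0 int) \<Rightarrow> ('k \<Rightarrow>\<^sub>0 int)) \<Rightarrow> bool"
  where "based_module_iso R M N f \<longleftrightarrow>
    bij_betw f (carrier M) (carrier N) \<and>
    (\<forall>x\<in>carrier M. \<forall>y\<in>carrier M. f (x \<oplus>\<^bsub>M\<^esub> y) = f x \<oplus>\<^bsub>N\<^esub> f y) \<and>
    (\<forall>r\<in>carrier R. \<forall>x\<in>carrier M. f (r \<odot>\<^bsub>M\<^esub> x) = r \<odot>\<^bsub>N\<^esub> f x) \<and>
    (\<forall>b\<in>module_basis M. f (frag_of b) \<in> frag_of ` module_basis N)"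

definition isomorphic_modules ::
    "('i, 'm) based_ring_data_scheme \<Rightarrow> ('i, 'j, 'n) based_module_data_scheme \<Rightarrow>
     ('i, 'k, 'l) based_module_data_scheme \<Rightarrow> bool"
  where "isomorphic_modules R M N \<longleftrightarrow> (\<exists>f. based_module_iso R M N f)"

text \<open>
  A definition cannot quantify over all types of module bases. Since \<open>\<alpha> \<otimes> b\<close> has finite support,
  the basis of a connected module injects into \<open>basis R \<times> \<nat>\<close>, so modules with basis
  contained in the type \<open>'i \<times> nat\<close> suffice; see \<open>torsion_freeD\<close> below.
\<close>

definition torsion_free :: "'i based_ring_data \<Rightarrow> bool"
  where "torsion_free R \<longleftrightarrow>
    (\<forall>M :: ('i, 'i \<times> nat) based_module_data.
       cofinite_based_module R M \<and> carrier M \<noteq> {\<zero>\<^bsub>M\<^esub>} \<and> connected_module R M \<longrightarrow>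
       isomorphic_modules R M (standard_module R))"


context cofinite_based_module
begin

lemma module_carrier_iff: "x \<in> carrier M \<longleftrightarrow> Poly_Mapping.keys x \<subseteq> module_basis M"
  by (simp add: module_carrier_eq free_Abelian_group_def)

lemma module_minus_closed: "\<lbrakk>x \<in> carrier M; y \<in> carrier M\<rbrakk> \<Longrightarrow> x - y \<in> carrier M"
  unfolding module_carrier_iff using keys_diff[of x y] by auto

lemma tau_form_eq_lookup:
  assumes "x \<in> carrier M" and c: "c \<in> module_basis M"
  shows "tau R (form M x (frag_of c)) = Poly_Mapping.lookup x c"
proof -
  have cM: "frag_of c \<in> carrier M" using c by (simp add: module_carrier_iff)
  have "Poly_Mapping.keys x \<subseteq> module_basis M"
    using assms(1) by (simp add: module_carrier_iff)
  then have "x \<in> carrier M \<and> tau R (form M x (frag_of c)) = Poly_Mapping.lookup x c"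
  proof (induction rule: frag_induction)
    case zero
    have z: "0 \<in> carrier M" by (simp add: module_carrier_iff)
    have "form M (0 \<oplus>\<^bsub>M\<^esub> 0) (frag_of c) = form M 0 (frag_of c) \<oplus> form M 0 (frag_of c)"
      using z cM by (intro form_add_left)
    then show ?case using z by (simp add: module_add_eq add_eq tau_def)
  next
    case (one b)
    then show ?case using c by (simp add: tau_form module_carrier_iff)
  next
    case (diff x y)
    then have d: "x - y \<in> carrier M" by (simp add: module_minus_closed)
    have "form M ((x - y) \<oplus>\<^bsub>M\<^esub> y) (frag_of c) = form M (x - y) (frag_of c) \<oplus> form M y (frag_of c)"
      using d diff cM by (intro form_add_left) auto
    then have "form M (x - y) (frag_of c) = form M x (frag_of c) - form M y (frag_of c)"
      by (simp add: module_add_eq add_eq)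
    then show ?case using d diff by (simp add: tau_diff lookup_minus)
  qed
  then show ?thesis by simp
qed

lemma module_const_lookup:
  assumes "a \<in> basis R" "b \<in> module_basis M" "c \<in> module_basis M"
  shows "module_const R M a b c = Poly_Mapping.lookup (frag_of a \<odot>\<^bsub>M\<^esub> frag_of b) c"
proof -
  have "frag_of a \<odot>\<^bsub>M\<^esub> frag_of b \<in> carrier M"
    using assms by (intro smult_closed frag_of_closed) (auto simp: module_carrier_iff)
  then show ?thesis
    unfolding module_const_def using assms by (simp add: form_smult[symmetric] tau_form_eq_lookup)
qed

lemma connected_module_embedding:
  assumes "connected_module R M"
  obtains g :: "'j \<Rightarrow> 'i \<times> nat" where "inj_on g (module_basis M)"
proof (cases "module_basis M = {}")
  case True
  then show ?thesis using that by simp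
next
  case False
  then obtain b where b: "b \<in> module_basis M" by blast
  then have "\<forall>c\<in>module_basis M. \<exists>a\<in>basis R. module_const R M a b c \<noteq> 0"
    using assms by (simp add: connected_module_def)
  then obtain h where h: "\<And>c. c \<in> module_basis M \<Longrightarrow> h c \<in> basis R \<and> module_const R M (h c) b c \<noteq> 0"
    by metis
  define K where "K a = Poly_Mapping.keys (frag_of a \<odot>\<^bsub>M\<^esub> frag_of b)" for a
  have K: "c \<in> K (h c)" if "c \<in> module_basis M" for c
    using h[OF that] b that module_const_lookup[of "h c" b c] by (simp add: K_def in_keys_iff)
  have "countable (K a)" for a by (simp add: K_def countable_finite)
  then have inj: "inj_on (to_nat_on (K a)) (K a)" for a by (rule inj_on_to_nat_on)
  have "inj_on (\<lambda>c. (h c, to_nat_on (K (h c)) c)) (module_basis M)"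
    by (rule inj_onI) (metis K Pair_inject inj inj_onD)
  then show ?thesis by (rule that)
qed

text \<open>Relabelling of a module basis.\<close>

lemma relabel_module:
  fixes g :: "'j \<Rightarrow> 'k"
  assumes inj: "inj_on g (module_basis M)"
  obtains N :: "('i, 'k) based_module_data"
  where "cofinite_based_module R N" "based_module_iso R M N (frag_extend (frag_of \<circ> g))"
    "carrier M \<noteq> {\<zero>\<^bsub>M\<^esub>} \<Longrightarrow> carrier N \<noteq> {\<zero>\<^bsub>N\<^esub>}"
    "connected_module R M \<Longrightarrow> connected_module R N"
proof -
  define J where "J = module_basis M"
  define h where "h = inv_into J g"
  define G :: "('j \<Rightarrow>\<^sub>0 int) \<Rightarrow> ('k \<Rightarrow>\<^sub>0 int)" where "G = frag_extend (frag_of \<circ> g)"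
  define H :: "('k \<Rightarrow>\<^sub>0 int) \<Rightarrow> ('j \<Rightarrow>\<^sub>0 int)" where "H = frag_extend (frag_of \<circ> h)"
  have hg: "h (g b) = b" if "b \<in> J" for b using inj that by (simp add: h_def J_def)
  have M_iff: "x \<in> carrier M \<longleftrightarrow> Poly_Mapping.keys x \<subseteq> J" for x
    by (simp add: module_carrier_iff J_def)
  have G_keys: "Poly_Mapping.keys (G x) \<subseteq> g ` J" if "x \<in> carrier M" for x
    using that keys_frag_extend[of "frag_of \<circ> g" x] by (force simp: M_iff G_def)
  have H_closed: "H y \<in> carrier M" if "Poly_Mapping.keys y \<subseteq> g ` J" for y
    using that keys_frag_extend[of "frag_of \<circ> h" y] hg by (force simp: M_iff H_def)
  have HG: "H (G x) = x" if "x \<in> carrier M" for x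
  proof -
    have "H (G x) = frag_extend (frag_of \<circ> h \<circ> g) x" by (simp add: H_def G_def frag_extend_compose)
    also have "\<dots> = frag_extend frag_of x"
      using that hg by (intro frag_extend_eq) (auto simp: M_iff)
    finally show ?thesis by (simp flip: frag_expansion)
  qed
  have GH: "G (H y) = y" if "Poly_Mapping.keys y \<subseteq> g ` J" for y
  proof -
    have "G (H y) = frag_extend (frag_of \<circ> g \<circ> h) y" by (simp add: H_def G_def frag_extend_compose)
    also have "\<dots> = frag_extend frag_of y"
      using that hg by (intro frag_extend_eq) auto
    finally show ?thesis by (simp flip: frag_expansion)
  qed
  have G_add: "G (x + y) = G x + G y" for x y by (simp add: G_def frag_extend_add)
  have H_add: "H (x + y) = H x + H y" for x y by (simp add: H_def frag_extend_add)
  have G_of: "G (frag_of b) = frag_of (g b)" for b by (simp add: G_def)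
  have H_of: "H (frag_of (g b)) = frag_of b" if "b \<in> J" for b using that hg by (simp add: H_def)
  define N :: "('i, 'k) based_module_data" where
    "N = \<lparr>carrier = carrier (free_Abelian_group (g ` J)), monoid.mult = undefined, one = undefined,
      ring.zero = 0, add = (+), smult = (\<lambda>a y. G (a \<odot>\<^bsub>M\<^esub> H y)), module_basis = g ` J,
      form = (\<lambda>x y. form M (H x) (H y))\<rparr>"
  have N_iff: "y \<in> carrier N \<longleftrightarrow> Poly_Mapping.keys y \<subseteq> g ` J" for y
    by (simp add: N_def free_Abelian_group_def)
  have N_simps: "add N = (+)" "\<zero>\<^bsub>N\<^esub> = 0" "module_basis N = g ` J"
    "\<And>a y. a \<odot>\<^bsub>N\<^esub> y = G (a \<odot>\<^bsub>M\<^esub> H y)" "\<And>x y. form N x y = form M (H x) (H y)"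
    by (simp_all add: N_def)
  have GN: "G x \<in> carrier N" if "x \<in> carrier M" for x using G_keys that by (simp add: N_iff)
  have HN: "H y \<in> carrier M" if "y \<in> carrier N" for y using H_closed that by (simp add: N_iff)
  have GHN: "G (H y) = y" if "y \<in> carrier N" for y using GH that by (simp add: N_iff)
  have ab: "abelian_group N"
  proof (rule abelian_groupI)
    show "\<exists>y\<in>carrier N. y \<oplus>\<^bsub>N\<^esub> x = \<zero>\<^bsub>N\<^esub>" if "x \<in> carrier N" for x
      using that by (intro bexI[of _ "- x"]) (auto simp: N_iff N_simps)
    show "x \<oplus>\<^bsub>N\<^esub> y \<in> carrier N" if "x \<in> carrier N" "y \<in> carrier N" for x y
      using that keys_add[of x y] by (auto simp: N_iff N_simps)
  qed (auto simp: N_iff N_simps algebra_simps)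
  have lm: "left_module R N"
  proof (intro left_module.intro left_module_axioms.intro ab)
    show "Ring.ring R" by (rule ring_axioms)
  next
    fix a x assume "a \<in> carrier R" "x \<in> carrier N"
    then show "a \<odot>\<^bsub>N\<^esub> x \<in> carrier N" by (simp add: N_simps GN HN smult_closed)
  next
    fix a b x assume "a \<in> carrier R" "b \<in> carrier R" "x \<in> carrier N"
    then show "(a \<oplus> b) \<odot>\<^bsub>N\<^esub> x = a \<odot>\<^bsub>N\<^esub> x \<oplus>\<^bsub>N\<^esub> b \<odot>\<^bsub>N\<^esub> x"
      using smult_l_distr[of a b "H x"] by (simp add: N_simps module_add_eq HN G_add)
  next
    fix a x y assume "a \<in> carrier R" "x \<in> carrier N" "y \<in> carrier N"
    then show "a \<odot>\<^bsub>N\<^esub> (x \<oplus>\<^bsub>N\<^esub> y) = a \<odot>\<^bsub>N\<^esub> x \<oplus>\<^bsub>N\<^esub> a \<odot>\<^bsub>N\<^esub> y"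
      using smult_r_distr[of a "H x" "H y"] by (simp add: N_simps module_add_eq HN G_add H_add)
  next
    fix a b x assume "a \<in> carrier R" "b \<in> carrier R" "x \<in> carrier N"
    then show "(a \<otimes> b) \<odot>\<^bsub>N\<^esub> x = a \<odot>\<^bsub>N\<^esub> (b \<odot>\<^bsub>N\<^esub> x)"
      by (simp add: N_simps HN HG smult_closed smult_assoc)
  next
    fix x assume "x \<in> carrier N"
    then show "\<one> \<odot>\<^bsub>N\<^esub> x = x" by (simp add: N_simps HN smult_one GHN)
  qed
  have smult_M: "frag_of a \<odot>\<^bsub>M\<^esub> frag_of b \<in> carrier M" if "a \<in> basis R" "b \<in> J" for a b
    using that by (intro smult_closed frag_of_closed) (auto simp: M_iff)
  have N1: "cofinite_based_module R N"
  proof (intro cofinite_based_module.intro cofinite_based_module_axioms.intro lm)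
    show "based_ring R" by (rule based_ring_axioms)
    show "carrier N = carrier (free_Abelian_group (module_basis N))" by (simp add: N_def)
    show "\<zero>\<^bsub>N\<^esub> = 0" "add N = (+)" by (simp_all add: N_simps)
  next
    fix x y assume "x \<in> carrier N" "y \<in> carrier N"
    then show "form N x y \<in> carrier R" by (simp add: N_simps HN form_closed)
  next
    fix x y z assume "x \<in> carrier N" "y \<in> carrier N" "z \<in> carrier N"
    then show "form N (x \<oplus>\<^bsub>N\<^esub> y) z = form N x z \<oplus> form N y z"
      "form N x (y \<oplus>\<^bsub>N\<^esub> z) = form N x y \<oplus> form N x z"
      using form_add_left[of "H x" "H y" "H z"] form_add_right[of "H x" "H y" "H z"]
      by (simp_all add: N_simps module_add_eq HN H_add)
  next
    fix a b c assume "a \<in> basis R" "b \<in> module_basis N" "c \<in> module_basis N"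
    then obtain b' c' where "a \<in> basis R" "b' \<in> J" "c' \<in> J" "b = g b'" "c = g c'"
      by (auto simp: N_simps)
    then show "form N (frag_of a \<odot>\<^bsub>N\<^esub> frag_of b) (frag_of c) = frag_of a \<otimes> form N (frag_of b) (frag_of c)"
      "0 \<le> tau R (frag_of a \<otimes> form N (frag_of b) (frag_of c))"
      by (simp_all add: N_simps H_of HG smult_M form_smult tau_mult_form_nonneg flip: J_def)
  next
    fix b c assume "b \<in> module_basis N" "c \<in> module_basis N"
    then obtain b' c' where bc: "b' \<in> J" "c' \<in> J" "b = g b'" "c = g c'"
      by (auto simp: N_simps)
    then show "form N (frag_of b) (frag_of c) = bar R (form N (frag_of c) (frag_of b))"
      using form_bar[of b' c'] by (simp add: N_simps H_of flip: J_def)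
    have "(b = c) = (b' = c')" using bc hg by metis
    then show "tau R (form N (frag_of b) (frag_of c)) = (if b = c then 1 else 0)"
      using bc by (simp add: N_simps H_of tau_form flip: J_def)
  qed
  have N2: "based_module_iso R M N G"
    unfolding based_module_iso_def
  proof (intro conjI ballI)
    show "bij_betw G (carrier M) (carrier N)"
      by (rule bij_betwI[of _ _ _ H]) (auto simp: GN HN HG GHN)
    fix b assume "b \<in> module_basis M"
    then show "G (frag_of b) \<in> frag_of ` module_basis N" by (simp add: G_of N_simps J_def)
  qed (simp_all add: N_simps module_add_eq G_add HG)
  have N3: "carrier N \<noteq> {\<zero>\<^bsub>N\<^esub>}" if "carrier M \<noteq> {\<zero>\<^bsub>M\<^esub>}"
  proof -
    have "J \<noteq> {}"
      using that by (auto simp: module_carrier_eq free_Abelian_group_def module_zero_eq simp flip: J_def)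
    then obtain b where "b \<in> J" by blast
    then have "frag_of (g b) \<in> carrier N" by (simp add: N_iff)
    then show ?thesis by (auto simp: N_simps)
  qed
  have N4: "connected_module R N" if "connected_module R M"
    using that unfolding connected_module_def module_const_def
    by (auto simp: N_simps H_of simp flip: J_def)
  show ?thesis by (rule that[OF N1 N2[unfolded G_def] N3 N4])
qed

end

lemma based_module_iso_comp:
  assumes "based_module_iso R M N f" "based_module_iso R N P f'"
  shows "based_module_iso R M P (f' \<circ> f)"
  unfolding based_module_iso_def
proof (intro conjI ballI)
  have bij: "bij_betw f (carrier M) (carrier N)" "bij_betw f' (carrier N) (carrier P)"
    using assms by (auto simp only: based_module_iso_def)
  then show "bij_betw (f' \<circ> f) (carrier M) (carrier P)" by (rule bij_betw_trans)
  have f: "f x \<in> carrier N" if "x \<in> carrier M" for x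
    using bij(1) that by (rule bij_betw_apply)
  show "(f' \<circ> f) (x \<oplus>\<^bsub>M\<^esub> y) = (f' \<circ> f) x \<oplus>\<^bsub>P\<^esub> (f' \<circ> f) y" if "x \<in> carrier M" "y \<in> carrier M" for x y
    using assms that f[OF that(1)] f[OF that(2)] unfolding based_module_iso_def by simp
  show "(f' \<circ> f) (r \<odot>\<^bsub>M\<^esub> x) = r \<odot>\<^bsub>P\<^esub> (f' \<circ> f) x" if "r \<in> carrier R" "x \<in> carrier M" for r x
    using assms that f[OF that(2)] unfolding based_module_iso_def by simp
  show "(f' \<circ> f) (frag_of b) \<in> frag_of ` module_basis P" if "b \<in> module_basis M" for b
  proof -
    obtain c where "c \<in> module_basis N" "f (frag_of b) = frag_of c"
      using assms(1) \<open>b \<in> module_basis M\<close> unfolding based_module_iso_def by blast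
    then show ?thesis using assms(2) unfolding based_module_iso_def by simp
  qed
qed

lemma torsion_freeD:
  fixes M :: "('i, 'j, 'n) based_module_data_scheme"
  assumes "torsion_free R" "cofinite_based_module R M"
    and "carrier M \<noteq> {\<zero>\<^bsub>M\<^esub>}" "connected_module R M"
  shows "isomorphic_modules R M (standard_module R)"
proof -
  interpret cofinite_based_module R M by fact
  obtain g :: "'j \<Rightarrow> 'i \<times> nat" where "inj_on g (module_basis M)"
    using connected_module_embedding assms by blast
  then obtain N :: "('i, 'i \<times> nat) based_module_data" where
    "cofinite_based_module R N" "based_module_iso R M N (frag_extend (frag_of \<circ> g))"
    "carrier N \<noteq> {\<zero>\<^bsub>N\<^esub>}" "connected_module R N"
    using relabel_module[of g] assms by metis
  then show ?thesis
    using assms(1) based_module_iso_comp[of R M N] unfolding torsion_free_def isomorphic_modules_def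
    by meson
qed


section \<open>Free products\<close>

text \<open>
  A letter from \<open>I\<^sub>s - {\<one>\<^sub>s}\<close> is a pair \<open>(s, a)\<close>, which makes the union of the alphabets disjoint.
\<close>

definition alternating_words ::
    "'s set \<Rightarrow> ('s \<Rightarrow> ('i, 'm) based_ring_data_scheme) \<Rightarrow> ('s \<times> 'i) list set"
  where "alternating_words S A =
    {w. (\<forall>(s, a)\<in>set w. s \<in> S \<and> a \<in> basis (A s) - {unit_index (A s)}) \<and>
        successively (\<lambda>p q. fst p \<noteq> fst q) w}"

text \<open>
  The recursion consumes the last letter of the left factor, which is therefore passed reversed:
  \<open>word_mult_rev A (rev u) v\<close> is the product of the words \<open>u\<close> and \<open>v\<close>. The sum omits the
  \<open>c\<close> with vanishing coefficient because HOL sums need a finite index set; for a based ring the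
  remaining set is finite by \<open>based_ring.finite_struct_const\<close>.
\<close>

fun word_mult_rev :: "('s \<Rightarrow> ('i, 'm) based_ring_data_scheme) \<Rightarrow>
    ('s \<times> 'i) list \<Rightarrow> ('s \<times> 'i) list \<Rightarrow> (('s \<times> 'i) list \<Rightarrow>\<^sub>0 int)"
  where
    "word_mult_rev A [] z = frag_of z"
  | "word_mult_rev A (p # w) [] = frag_of (rev (p # w))"
  | "word_mult_rev A ((s, a) # w) ((t, b) # z) =
      (if s = t
       then frag_cmul (struct_const (A s) a b (unit_index (A s))) (word_mult_rev A w z)
         + (\<Sum>c\<in>{c \<in> basis (A s) - {unit_index (A s)}. struct_const (A s) a b c \<noteq> 0}.
              frag_cmul (struct_const (A s) a b c) (frag_of (rev w @ (s, c) # z)))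
       else frag_of (rev w @ (s, a) # (t, b) # z))"

definition word_mult :: "('s \<Rightarrow> ('i, 'm) based_ring_data_scheme) \<Rightarrow>
    ('s \<times> 'i) list \<Rightarrow> ('s \<times> 'i) list \<Rightarrow> (('s \<times> 'i) list \<Rightarrow>\<^sub>0 int)"
  where "word_mult A u v = word_mult_rev A (rev u) v"

definition word_conj ::
    "('s \<Rightarrow> ('i, 'm) based_ring_data_scheme) \<Rightarrow> ('s \<times> 'i) list \<Rightarrow> ('s \<times> 'i) list"
  where "word_conj A w = rev (map (\<lambda>(s, a). (s, conj_index (A s) a)) w)"

definition free_product ::
    "'s set \<Rightarrow> ('s \<Rightarrow> ('i, 'm) based_ring_data_scheme) \<Rightarrow> ('s \<times> 'i) list based_ring_data"
  where "free_product S A =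
    \<lparr>carrier = carrier (free_Abelian_group (alternating_words S A)),
     monoid.mult = (\<lambda>x y. frag_extend (\<lambda>u. frag_extend (word_mult A u) y) x),
     one = frag_of [], ring.zero = 0, add = (+),
     basis = alternating_words S A, unit_index = [], conj_index = word_conj A\<rparr>"

lemma word_mult_Nil_left: "word_mult A [] z = frag_of z"
  by (simp add: word_mult_def)

lemma word_mult_Nil_right: "word_mult A w [] = frag_of w"
proof (cases "rev w")
  case (Cons p u)
  then have "w = rev (p # u)" by (metis rev_rev_ident)
  then show ?thesis by (simp add: word_mult_def)
qed (simp add: word_mult_def)

lemma word_mult_neq:
  "s \<noteq> t \<Longrightarrow> word_mult A (w @ [(s, a)]) ((t, b) # z) = frag_of (w @ [(s, a)] @ [(t, b)] @ z)"
  by (simp add: word_mult_def)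

lemma word_mult_eq:
  "word_mult A (w @ [(s, a)]) ((s, b) # z) =
     frag_cmul (struct_const (A s) a b (unit_index (A s))) (word_mult A w z)
     + (\<Sum>c\<in>{c \<in> basis (A s) - {unit_index (A s)}. struct_const (A s) a b c \<noteq> 0}.
          frag_cmul (struct_const (A s) a b c) (frag_of (w @ [(s, c)] @ z)))"
  by (simp add: word_mult_def)

end

theory Submission
  imports Defs
begin

text \<open>
  Associativity of the word product is van der Waerden's trick: writing every word uniquely as \<open>a z\<close>
  with \<open>a \<in> I\<^sub>s\<close> (possibly the unit) and \<open>z\<close> not starting in \<open>I\<^sub>s\<close>, the letters of each \<open>A\<^sub>s\<close> act on words
  through a representation of \<open>A\<^sub>s\<close>. The product of the dimensions of the letters is a dimension function \<open>d\<close>.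

  Let \<open>J\<close> be the basis of a connected module. Torsion-freeness of \<open>A\<^sub>s\<close> makes the \<open>A\<^sub>s\<close>-component of
  every \<open>b \<in> J\<close> a copy of the standard module; let \<open>c\<close> be its unit, so \<open>b = \<beta> \<otimes> c\<close> and
  \<open>d\<langle>b, b\<rangle> = d(\<beta>)\<^sup>2 d\<langle>c, c\<rangle>\<close>. If a word \<open>w \<noteq> \<one>\<close> has \<open>b\<close> as a constituent of \<open>w \<otimes> b\<close>, some element of \<open>J\<close>
  has at most half the value \<open>d\<langle>b, b\<rangle>\<close>, by induction on the length of \<open>w\<close>. For a single letter,
  \<open>\<beta> \<otimes> bar \<beta> \<noteq> \<one>\<close> and \<open>d(\<beta>)\<^sup>2 \<ge> 2\<close>. A cyclically reduced \<open>w\<close> is impossible, since all its powers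
  would occur in \<open>\<langle>b, b\<rangle>\<close>. Otherwise the first and last letters of \<open>w = \<alpha> u \<gamma>\<close> lie in the same \<open>I\<^sub>s\<close>, and conjugating by
  \<open>\<gamma>\<close> passes to an element of the same \<open>A\<^sub>s\<close>-component stabilized by the shorter word \<open>u\<close>. As
  \<open>d\<langle>b, b\<rangle> \<ge> 1\<close>, halving stops at some \<open>b\<close> with \<open>\<langle>b, b\<rangle> = \<one>\<close>, and acting on it
  identifies the module with the standard one.
\<close>

section \<open>Integer linear combinations\<close>

lemma lookup_frag_extend:
  "Poly_Mapping.lookup (frag_extend f x) j =
     (\<Sum>i\<in>Poly_Mapping.keys x. Poly_Mapping.lookup x i * Poly_Mapping.lookup (f i) j)"
  by (simp add: frag_extend_def lookup_sum)

lemma frag_extend_frag_extend: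
  "frag_extend f (frag_extend g x) = frag_extend (\<lambda>i. frag_extend f (g i)) x"
  using subset_UNIV[of "Poly_Mapping.keys x"]
  by (induction x rule: frag_induction) (auto simp: frag_extend_diff)

lemma frag_extend_frag_of_id: "frag_extend frag_of x = x"
  by (simp flip: frag_expansion)

lemma frag_extend_fun_add: "frag_extend (\<lambda>i. f i + g i) x = frag_extend f x + frag_extend g x"
  by (rule poly_mapping_eqI) (simp add: lookup_frag_extend lookup_add sum.distrib algebra_simps)

lemma frag_extend_fun_diff: "frag_extend (\<lambda>i. f i - g i) x = frag_extend f x - frag_extend g x"
  by (rule poly_mapping_eqI) (simp add: lookup_frag_extend lookup_minus sum_subtractf algebra_simps)

definition frag_nonneg :: "('a \<Rightarrow>\<^sub>0 int) \<Rightarrow> bool"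
  where "frag_nonneg x \<longleftrightarrow> (\<forall>i. 0 \<le> Poly_Mapping.lookup x i)"

lemma frag_nonneg_of: "frag_nonneg (frag_of i)"
  by (simp add: frag_nonneg_def)

lemma frag_nonneg_extend:
  assumes "frag_nonneg x" "\<And>i. i \<in> Poly_Mapping.keys x \<Longrightarrow> frag_nonneg (f i)"
  shows "frag_nonneg (frag_extend f x)"
  using assms by (auto simp: frag_nonneg_def lookup_frag_extend intro!: sum_nonneg)

text \<open>Nonnegative coefficients cannot cancel, so a coefficient of the sum vanishes only if
  every contribution does. This reduces later questions about products to the mere presence of
  constituents.\<close>

lemma lookup_frag_extend_neq_0_iff:
  assumes "frag_nonneg x" "\<And>i. i \<in> Poly_Mapping.keys x \<Longrightarrow> frag_nonneg (f i)"
  shows "Poly_Mapping.lookup (frag_extend f x) j \<noteq> 0 \<longleftrightarrow>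
    (\<exists>i. Poly_Mapping.lookup x i \<noteq> 0 \<and> Poly_Mapping.lookup (f i) j \<noteq> 0)"
  unfolding lookup_frag_extend
  by (subst sum_nonneg_eq_0_iff) (use assms in \<open>auto simp: frag_nonneg_def in_keys_iff\<close>)

text \<open>The additive extension to the free abelian group of a real function on its basis; every
  dimension function has this form.\<close>

definition real_extend :: "('a \<Rightarrow> real) \<Rightarrow> ('a \<Rightarrow>\<^sub>0 int) \<Rightarrow> real"
  where "real_extend f x = (\<Sum>i\<in>Poly_Mapping.keys x. of_int (Poly_Mapping.lookup x i) * f i)"

lemma real_extend_superset:
  assumes "finite K" "Poly_Mapping.keys x \<subseteq> K"
  shows "real_extend f x = (\<Sum>i\<in>K. of_int (Poly_Mapping.lookup x i) * f i)"
  unfolding real_extend_def using assms by (intro sum.mono_neutral_left) (auto simp: in_keys_iff)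

lemma real_extend_zero [simp]: "real_extend f 0 = 0"
  by (simp add: real_extend_def)

lemma real_extend_of [simp]: "real_extend f (frag_of i) = f i"
  by (simp add: real_extend_def)

lemma real_extend_diff: "real_extend f (x - y) = real_extend f x - real_extend f y"
  using keys_diff[of x y]
  by (simp add: real_extend_superset[of "Poly_Mapping.keys x \<union> Poly_Mapping.keys y"]
      lookup_minus sum_subtractf algebra_simps)

lemma real_extend_add: "real_extend f (x + y) = real_extend f x + real_extend f y"
  using keys_add[of x y]
  by (simp add: real_extend_superset[of "Poly_Mapping.keys x \<union> Poly_Mapping.keys y"]
      lookup_add sum.distrib algebra_simps)

lemma real_extend_frag_extend:
  "real_extend f (frag_extend g x) = real_extend (\<lambda>i. real_extend f (g i)) x"
  using subset_UNIV[of "Poly_Mapping.keys x"]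
  by (induction x rule: frag_induction) (auto simp: real_extend_diff frag_extend_diff)

lemma real_extend_cong:
  "(\<And>i. i \<in> Poly_Mapping.keys x \<Longrightarrow> f i = g i) \<Longrightarrow> real_extend f x = real_extend g x"
  by (simp add: real_extend_def)

lemma real_extend_scale: "real_extend (\<lambda>i. r * f i) x = r * real_extend f x"
  by (simp add: real_extend_def sum_distrib_left algebra_simps)

section \<open>Based rings\<close>

context based_ring
begin

lemma carrier_iff: "x \<in> carrier R \<longleftrightarrow> Poly_Mapping.keys x \<subseteq> basis R"
  by (simp add: carrier_eq free_Abelian_group_def)

lemma frag_extend_closed:
  assumes "\<And>i. i \<in> Poly_Mapping.keys x \<Longrightarrow> f i \<in> carrier R"
  shows "frag_extend f x \<in> carrier R"
  using assms keys_frag_extend[of f x] unfolding carrier_iff by blast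

lemma mult_expand_left:
  assumes "x \<in> carrier R" "y \<in> carrier R"
  shows "x \<otimes> y = frag_extend (\<lambda>a. frag_of a \<otimes> y) x"
proof -
  have "Poly_Mapping.keys x \<subseteq> basis R" using assms by (simp add: carrier_iff)
  then have "x \<in> carrier R \<and> x \<otimes> y = frag_extend (\<lambda>a. frag_of a \<otimes> y) x"
  proof (induction rule: frag_induction)
    case zero
    then show ?case using assms(2) l_null[of y] zero_closed by (simp add: zero_eq)
  next
    case (diff x z)
    then show ?case using assms(2) by (simp add: frag_extend_diff mult_diff_left minus_closed')
  qed (simp add: frag_of_closed)
  then show ?thesis by simp
qed

lemma mult_expand_right:
  assumes "x \<in> carrier R" "y \<in> carrier R"
  shows "x \<otimes> y = frag_extend (\<lambda>b. x \<otimes> frag_of b) y"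
proof -
  have "Poly_Mapping.keys y \<subseteq> basis R" using assms by (simp add: carrier_iff)
  then have "y \<in> carrier R \<and> x \<otimes> y = frag_extend (\<lambda>b. x \<otimes> frag_of b) y"
  proof (induction rule: frag_induction)
    case zero
    then show ?case using assms(1) r_null[of x] zero_closed by (simp add: zero_eq)
  next
    case (diff y z)
    then show ?case using assms(1) by (simp add: frag_extend_diff mult_diff_right minus_closed')
  qed (simp add: frag_of_closed)
  then show ?thesis by simp
qed

lemma bar_frag_of: "bar R (frag_of a) = frag_of (conj_index R a)"
  by (simp add: bar_def)

lemma bar_closed: "x \<in> carrier R \<Longrightarrow> bar R x \<in> carrier R"
  unfolding bar_def by (rule frag_extend_closed) (auto simp: carrier_iff conj_index_in_basis)

text \<open>The coefficient at \<open>c\<close> is the trace of a triple product with the conjugate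
  of \<open>c\<close>, again a basis element, so the positivity axiom applies.\<close>

lemma frag_nonneg_mult_basis:
  assumes "a \<in> basis R" "b \<in> basis R"
  shows "frag_nonneg (frag_of a \<otimes> frag_of b)"
  unfolding frag_nonneg_def
proof
  fix c
  have ab: "frag_of a \<otimes> frag_of b \<in> carrier R" using assms by (simp add: frag_of_closed)
  show "0 \<le> Poly_Mapping.lookup (frag_of a \<otimes> frag_of b) c"
  proof (cases "c \<in> basis R")
    case True
    then show ?thesis
      using tau_mult_bar[OF ab True] tau_mult_nonneg[OF assms conj_index_in_basis[OF True]]
      by (simp add: bar_frag_of)
  next
    case False
    then have "c \<notin> Poly_Mapping.keys (frag_of a \<otimes> frag_of b)" using ab by (auto simp: carrier_iff)
    then show ?thesis by (simp add: in_keys_iff)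
  qed
qed

lemma tau_bar_mult':
  assumes "x \<in> carrier R" and c: "c \<in> basis R"
  shows "tau R (bar R (frag_of c) \<otimes> x) = Poly_Mapping.lookup x c"
proof -
  have cc: "bar R (frag_of c) \<in> carrier R" using c by (simp add: bar_closed frag_of_closed)
  have "Poly_Mapping.keys x \<subseteq> basis R" using assms by (simp add: carrier_iff)
  then have "x \<in> carrier R \<and> tau R (bar R (frag_of c) \<otimes> x) = Poly_Mapping.lookup x c"
  proof (induction rule: frag_induction)
    case zero
    then show ?case using r_null[OF cc] zero_closed by (simp add: zero_eq tau_def)
  next
    case (one a)
    then show ?case using tau_bar_mult[OF c] by (auto simp: frag_of_closed)
  next
    case (diff y z)
    then show ?case using cc by (simp add: mult_diff_right minus_closed' tau_diff lookup_minus)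
  qed
  then show ?thesis by simp
qed

text \<open>The trace property. For a basis element \<open>y\<close>, written as the conjugate of
  \<open>c\<close>, both sides read off the coefficient of \<open>x\<close> at \<open>c\<close>; the
  rest is linearity.\<close>

lemma tau_commute:
  assumes "x \<in> carrier R" "y \<in> carrier R"
  shows "tau R (x \<otimes> y) = tau R (y \<otimes> x)"
proof -
  have "Poly_Mapping.keys y \<subseteq> basis R" using assms by (simp add: carrier_iff)
  then have "y \<in> carrier R \<and> tau R (x \<otimes> y) = tau R (y \<otimes> x)"
  proof (induction rule: frag_induction)
    case zero
    then show ?case using assms(1) r_null[of x] l_null[of x] zero_closed by (simp add: zero_eq)
  next
    case (one a)
    define c where "c = conj_index R a"
    have c: "c \<in> basis R" "frag_of a = bar R (frag_of c)"
      using one by (auto simp: c_def bar_frag_of conj_index_in_basis conj_index_conj_index)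
    then show ?case using one assms(1) tau_mult_bar[of x c] tau_bar_mult'[of x c] frag_of_closed[of a]
      by simp
  next
    case (diff y z)
    then show ?case using assms(1)
      by (simp add: mult_diff_right mult_diff_left minus_closed' tau_diff)
  qed
  then show ?thesis by simp
qed

lemma lookup_mult_unit_index:
  assumes "a \<in> basis R" "b \<in> basis R"
  shows "Poly_Mapping.lookup (frag_of a \<otimes> frag_of b) (unit_index R) = (if b = conj_index R a then 1 else 0)"
  using tau_bar_mult[of "conj_index R a" b] assms
  by (auto simp: bar_frag_of conj_index_in_basis conj_index_conj_index tau_def)

section \<open>Dimension functions on a based ring\<close>

lemma dimension_function_diff:
  assumes "dimension_function R d" "x \<in> carrier R" "y \<in> carrier R"
  shows "d (x - y) = d x - d y"
proof -
  have "d ((x - y) \<oplus> y) = d (x - y) + d y"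
    using assms minus_closed' ring_hom_add[of d R real_ring "x - y" y]
    by (simp add: dimension_function_def real_ring_def)
  then show ?thesis by (simp add: add_eq)
qed

lemma dimension_function_extend:
  assumes "dimension_function R d" "x \<in> carrier R"
  shows "d x = real_extend (\<lambda>a. d (frag_of a)) x"
proof -
  have "Poly_Mapping.keys x \<subseteq> basis R" using assms by (simp add: carrier_iff)
  then have "x \<in> carrier R \<and> d x = real_extend (\<lambda>a. d (frag_of a)) x"
  proof (induction rule: frag_induction)
    case zero
    then show ?case
      using dimension_function_diff[OF assms(1), of 0 0] zero_closed by (simp add: zero_eq)
  next
    case (diff x y)
    then show ?case
      using dimension_function_diff[OF assms(1), of x y] by (simp add: real_extend_diff minus_closed')
  qed (simp add: frag_of_closed)
  then show ?thesis by simp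
qed

lemma dimension_function_mult:
  assumes "dimension_function R d" "x \<in> carrier R" "y \<in> carrier R"
  shows "d (x \<otimes> y) = d x * d y"
  using assms ring_hom_mult[of d R real_ring x y] by (simp add: dimension_function_def real_ring_def)

lemma dimension_function_one:
  assumes "dimension_function R d"
  shows "d (frag_of (unit_index R)) = 1"
  using assms ring_hom_one[of d R real_ring] by (simp add: dimension_function_def real_ring_def one_eq)

lemma dimension_function_bar:
  assumes "dimension_function R d" "x \<in> carrier R"
  shows "d (bar R x) = d x"
proof -
  have "d (bar R x) = real_extend (\<lambda>a. real_extend (\<lambda>a. d (frag_of a)) (frag_of (conj_index R a))) x"
    using dimension_function_extend[OF assms(1) bar_closed[OF assms(2)]]
    by (simp add: bar_def real_extend_frag_extend o_def)
  also have "\<dots> = real_extend (\<lambda>a. d (frag_of a)) x"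
    using assms by (intro real_extend_cong) (auto simp: dimension_function_def bar_frag_of carrier_iff)
  finally show ?thesis using dimension_function_extend[OF assms] by simp
qed

text \<open>Coefficients on the support are integers \<ge> 1 and dimensions of basis elements are
  positive, so discarding constituents and multiplicities only decreases \<open>d\<close>.\<close>

lemma sum_le_dimension_function:
  assumes d: "dimension_function R d" and x: "x \<in> carrier R" "frag_nonneg x"
    and K: "K \<subseteq> Poly_Mapping.keys x"
  shows "(\<Sum>a\<in>K. d (frag_of a)) \<le> d x"
proof -
  have pos: "d (frag_of a) > 0" if "a \<in> Poly_Mapping.keys x" for a
    using d x that by (auto simp: dimension_function_def carrier_iff)
  have ge: "1 \<le> Poly_Mapping.lookup x a" if "a \<in> Poly_Mapping.keys x" for a
  proof -
    have "0 \<le> Poly_Mapping.lookup x a" "Poly_Mapping.lookup x a \<noteq> 0"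
      using x(2) that by (auto simp: frag_nonneg_def in_keys_iff)
    then show ?thesis by linarith
  qed
  have "(\<Sum>a\<in>K. d (frag_of a)) \<le> (\<Sum>a\<in>Poly_Mapping.keys x. d (frag_of a))"
    using K pos by (intro sum_mono2) (auto intro: less_imp_le)
  also have "\<dots> \<le> real_extend (\<lambda>a. d (frag_of a)) x"
    unfolding real_extend_def using pos ge by (intro sum_mono) (simp add: less_imp_le)
  finally show ?thesis using dimension_function_extend[OF d x(1)] by simp
qed

lemma dimension_function_square:
  assumes "dimension_function R d" "a \<in> basis R"
  shows "(d (frag_of a))\<^sup>2 = d (frag_of a \<otimes> bar R (frag_of a))"
  using assms by (simp add: dimension_function_mult dimension_function_bar frag_of_closed bar_closed power2_eq_square)

lemma unit_index_in_keys_mult_bar: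
  assumes "a \<in> basis R"
  shows "unit_index R \<in> Poly_Mapping.keys (frag_of a \<otimes> bar R (frag_of a))"
  using assms lookup_mult_unit_index[of a "conj_index R a"]
  by (simp add: in_keys_iff bar_frag_of conj_index_in_basis)

text \<open>The unit, of dimension 1, is a constituent of \<open>a\<close> times its conjugate,
  whose dimension is the square of that of \<open>a\<close>.\<close>

lemma dimension_function_ge_1:
  assumes d: "dimension_function R d" and a: "a \<in> basis R"
  shows "1 \<le> d (frag_of a)"
proof -
  have "(\<Sum>c\<in>{unit_index R}. d (frag_of c)) \<le> (d (frag_of a))\<^sup>2"
    unfolding dimension_function_square[OF assms] using a unit_index_in_keys_mult_bar[OF a]
    by (intro sum_le_dimension_function[OF d])
       (auto simp: frag_of_closed bar_closed bar_frag_of frag_nonneg_mult_basis conj_index_in_basis)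
  then have "1 \<le> (d (frag_of a))\<^sup>2" by (simp add: dimension_function_one[OF d])
  moreover have "d (frag_of a) > 0" using assms unfolding dimension_function_def by blast
  ultimately show ?thesis by (metis less_imp_le one_power2 power2_le_imp_le)
qed

text \<open>A second constituent \<open>c\<close> besides the unit contributes at least 1
  more.\<close>

lemma dimension_function_square_ge_2:
  assumes d: "dimension_function R d" and a: "a \<in> basis R"
    and c: "c \<in> Poly_Mapping.keys (frag_of a \<otimes> bar R (frag_of a))" "c \<noteq> unit_index R"
  shows "2 \<le> (d (frag_of a))\<^sup>2"
proof -
  have cl: "frag_of a \<otimes> bar R (frag_of a) \<in> carrier R" using a by (simp add: frag_of_closed bar_closed)
  then have "c \<in> basis R" using c by (auto simp: carrier_iff)
  have "(\<Sum>c\<in>{unit_index R, c}. d (frag_of c)) \<le> (d (frag_of a))\<^sup>2"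
    unfolding dimension_function_square[OF d a] using a unit_index_in_keys_mult_bar[OF a] c
    by (intro sum_le_dimension_function[OF d cl])
       (auto simp: bar_frag_of frag_nonneg_mult_basis conj_index_in_basis)
  then show ?thesis
    using dimension_function_ge_1[OF d \<open>c \<in> basis R\<close>] c by (simp add: dimension_function_one[OF d])
qed

text \<open>The unit has multiplicity exactly 1 in \<open>a\<close> times its conjugate, so with no
  other constituent this product is the unit itself.\<close>

lemma dimension_function_invertible:
  assumes d: "dimension_function R d" and a: "a \<in> basis R"
    and "Poly_Mapping.keys (frag_of a \<otimes> bar R (frag_of a)) \<subseteq> {unit_index R}"
  shows "d (frag_of a) = 1"
proof -
  have "frag_of a \<otimes> bar R (frag_of a) = frag_of (unit_index R)"
  proof (rule poly_mapping_eqI)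
    fix k
    show "Poly_Mapping.lookup (frag_of a \<otimes> bar R (frag_of a)) k = Poly_Mapping.lookup (frag_of (unit_index R)) k"
      using assms(3) lookup_mult_unit_index[OF a conj_index_in_basis[OF a]]
      by (cases "k = unit_index R") (auto simp: bar_frag_of in_keys_iff)
  qed
  then have "(d (frag_of a))\<^sup>2 = 1"
    using dimension_function_square[OF d a] dimension_function_one[OF d] by simp
  then show ?thesis using dimension_function_ge_1[OF d a] by (simp add: power2_eq_1_iff)
qed

text \<open>Frobenius reciprocity: both coefficients are the trace of the product of
  \<open>a\<close>, \<open>b\<close> and the conjugate of \<open>b\<close>. So the stabilizer of
  \<open>b\<close> under left multiplication is visible in one product.\<close>

lemma lookup_mult_bar_iff:
  assumes "a \<in> basis R" "b \<in> basis R"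
  shows "conj_index R a \<in> Poly_Mapping.keys (frag_of b \<otimes> bar R (frag_of b)) \<longleftrightarrow>
    Poly_Mapping.lookup (frag_of a \<otimes> frag_of b) b \<noteq> 0"
proof -
  have "Poly_Mapping.lookup (frag_of a \<otimes> frag_of b) b = tau R (frag_of a \<otimes> frag_of b \<otimes> bar R (frag_of b))"
    using assms by (simp add: tau_mult_bar frag_of_closed)
  also have "\<dots> = tau R (bar R (frag_of (conj_index R a)) \<otimes> (frag_of b \<otimes> bar R (frag_of b)))"
    using assms by (simp add: m_assoc frag_of_closed bar_closed bar_frag_of conj_index_conj_index conj_index_in_basis)
  also have "\<dots> = Poly_Mapping.lookup (frag_of b \<otimes> bar R (frag_of b)) (conj_index R a)"
    using assms by (intro tau_bar_mult') (auto simp: frag_of_closed bar_closed conj_index_in_basis)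
  finally show ?thesis by (simp add: in_keys_iff)
qed

end

section \<open>The free product as a based ring\<close>

locale based_ring_family =
  fixes S :: "'s set" and A :: "'s \<Rightarrow> ('i, 'm) based_ring_data_scheme"
  assumes based_ring_A: "s \<in> S \<Longrightarrow> based_ring (A s)"
begin

abbreviation W :: "('s \<times> 'i) list set"
  where "W \<equiv> alternating_words S A"

abbreviation fp :: "('s \<times> 'i) list based_ring_data"
  where "fp \<equiv> free_product S A"

section \<open>Alternating words and their products\<close>

lemma alternating_words_Nil: "[] \<in> W"
  by (simp add: alternating_words_def)

lemma alternating_words_Cons:
  "(s, a) # w \<in> W \<longleftrightarrow>
    s \<in> S \<and> a \<in> basis (A s) \<and> a \<noteq> unit_index (A s) \<and> w \<in> W \<and> (w = [] \<or> fst (hd w) \<noteq> s)"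
  by (cases w) (auto simp: alternating_words_def)

lemma alternating_words_append:
  "u @ v \<in> W \<longleftrightarrow> u \<in> W \<and> v \<in> W \<and> (u = [] \<or> v = [] \<or> fst (last u) \<noteq> fst (hd v))"
  by (auto simp: alternating_words_def successively_append_iff)

lemma word_mult_concat:
  assumes "u = [] \<or> v = [] \<or> fst (last u) \<noteq> fst (hd v)"
  shows "word_mult A u v = frag_of (u @ v)"
proof (cases "u = [] \<or> v = []")
  case True
  then show ?thesis by (auto simp: word_mult_Nil_left word_mult_Nil_right)
next
  case False
  then obtain w s a t b z where "u = w @ [(s, a)]" "v = (t, b) # z"
    by (metis list.exhaust_sel rev_exhaust surj_pair)
  then show ?thesis using assms by (simp add: word_mult_neq)
qed

text \<open>This form absorbs the structure constants into the product of A_s: the unit summand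
  deletes the two letters and continues the recursion, any other summand merges them into one
  letter. Identities in A_s can then be inserted directly into inductions on words.\<close>

lemma word_mult_letters:
  assumes "s \<in> S" "a \<in> basis (A s)" "b \<in> basis (A s)"
  shows "word_mult A (w @ [(s, a)]) ((s, b) # z) =
    frag_extend (\<lambda>c. if c = unit_index (A s) then word_mult A w z else frag_of (w @ (s, c) # z))
      (frag_of a \<otimes>\<^bsub>A s\<^esub> frag_of b)" (is "?l = frag_extend ?F ?x")
proof -
  interpret R: based_ring "A s" using assms(1) by (rule based_ring_A)
  let ?e = "unit_index (A s)"
  let ?K = "{c \<in> basis (A s) - {?e}. struct_const (A s) a b c \<noteq> 0}"
  have x: "?x \<in> carrier (A s)" using assms by (simp add: R.frag_of_closed)
  have K: "?K = Poly_Mapping.keys ?x - {?e}"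
    using assms x by (auto simp: R.struct_const_lookup in_keys_iff R.carrier_iff)
  \<comment> \<open>The unit is added to the support so that its coefficient, possibly zero, can be
    split off.\<close>
  have "frag_extend ?F ?x = (\<Sum>c\<in>insert ?e (Poly_Mapping.keys ?x). frag_cmul (Poly_Mapping.lookup ?x c) (?F c))"
    unfolding frag_extend_def by (rule sum.mono_neutral_left) (auto simp: in_keys_iff)
  also have "\<dots> = frag_cmul (Poly_Mapping.lookup ?x ?e) (?F ?e)
      + (\<Sum>c\<in>?K. frag_cmul (Poly_Mapping.lookup ?x c) (?F c))"
    unfolding K by (simp add: sum.insert_remove)
  also have "\<dots> = ?l"
    unfolding word_mult_eq using assms
    by (intro arg_cong2[of _ _ _ _ "(+)"] sum.cong)
       (auto simp: R.struct_const_lookup R.unit_index_in_basis)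
  finally show ?thesis by simp
qed

text \<open>The unit of \<open>A\<^sub>s\<close> stands for the empty word, so that products of letters need no case distinction.\<close>

definition prepend :: "'s \<Rightarrow> ('s \<times> 'i) list \<Rightarrow> 'i \<Rightarrow> ('s \<times> 'i) list"
  where "prepend s z a = (if a = unit_index (A s) then z else (s, a) # z)"

lemma prepend_in_words:
  assumes "s \<in> S" "a \<in> basis (A s)" "z \<in> W" "z = [] \<or> fst (hd z) \<noteq> s"
  shows "prepend s z a \<in> W"
  using assms by (auto simp: prepend_def alternating_words_Cons)

text \<open>For fixed \<open>s\<close> this splits the set of words into copies of the basis of A_s,
  one for each word \<open>z\<close> not starting in I_s.\<close>

lemma prepend_cases:
  assumes "v \<in> W" "s \<in> S"
  obtains z a where "v = prepend s z a" "a \<in> basis (A s)" "z \<in> W" "z = [] \<or> fst (hd z) \<noteq> s"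
proof (cases "v = [] \<or> fst (hd v) \<noteq> s")
  case True
  then show ?thesis using assms based_ring.unit_index_in_basis[OF based_ring_A[of s]]
    by (intro that[of v "unit_index (A s)"]) (auto simp: prepend_def)
next
  case False
  then obtain a z where "v = (s, a) # z" by (metis list.exhaust_sel surjective_pairing)
  then show ?thesis using assms by (intro that[of z a]) (auto simp: prepend_def alternating_words_Cons)
qed

text \<open>On the copy of the basis of A_s attached to \<open>z\<close>, letters from A_s act
  exactly as left multiplication in A_s. The unit cases are separate because there a letter is
  absent from the word.\<close>

lemma word_mult_prepend:
  assumes s: "s \<in> S" and ac: "a \<in> basis (A s)" "c \<in> basis (A s)" and z: "z = [] \<or> fst (hd z) \<noteq> s"
  shows "word_mult A (prepend s [] a) (prepend s z c) =
    frag_extend (frag_of \<circ> prepend s z) (frag_of a \<otimes>\<^bsub>A s\<^esub> frag_of c)"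
proof -
  interpret R: based_ring "A s" using s by (rule based_ring_A)
  have one: "frag_of (unit_index (A s)) = \<one>\<^bsub>A s\<^esub>" by (simp add: R.one_eq)
  consider "a = unit_index (A s)" | "c = unit_index (A s)"
    | "a \<noteq> unit_index (A s)" "c \<noteq> unit_index (A s)" by blast
  then show ?thesis
  proof cases
    case 1
    then show ?thesis using ac by (simp add: one R.frag_of_closed)
        (simp add: prepend_def word_mult_Nil_left)
  next
    case 2
    then have "frag_of a \<otimes>\<^bsub>A s\<^esub> frag_of c = frag_of a"
      using ac by (simp add: one R.frag_of_closed)
    moreover have "word_mult A (prepend s [] a) z = frag_of (prepend s z a)"
      using z by (auto simp: prepend_def word_mult_concat)
    ultimately show ?thesis using 2 by (simp add: prepend_def)
  next
    case 3
    then have "word_mult A (prepend s [] a) (prepend s z c) = word_mult A ([] @ [(s, a)]) ((s, c) # z)"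
      by (simp add: prepend_def)
    also have "\<dots> = frag_extend (frag_of \<circ> prepend s z) (frag_of a \<otimes>\<^bsub>A s\<^esub> frag_of c)"
      unfolding word_mult_letters[OF s ac]
      by (intro frag_extend_eq) (auto simp: prepend_def word_mult_Nil_left)
    finally show ?thesis .
  qed
qed

lemma keys_word_mult:
  assumes "u \<in> W" "v \<in> W"
  shows "Poly_Mapping.keys (word_mult A u v) \<subseteq> W"
  using assms
proof (induction u arbitrary: v rule: rev_induct)
  case Nil
  then show ?case by (simp add: word_mult_Nil_left)
next
  case (snoc p w)
  obtain s a where p: "p = (s, a)" by force
  show ?case
  proof (cases "v = [] \<or> fst (hd v) \<noteq> s")
    case True
    then show ?thesis using snoc p
      by (subst word_mult_concat) (auto simp: alternating_words_append alternating_words_Cons)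
  next
    case False
    then obtain b z where v: "v = (s, b) # z" by (metis list.exhaust_sel surjective_pairing)
    have s: "s \<in> S" "a \<in> basis (A s)" "b \<in> basis (A s)" "w \<in> W" "z \<in> W"
      using snoc.prems by (auto simp: p v alternating_words_append alternating_words_Cons)
    interpret R: based_ring "A s" using s(1) by (rule based_ring_A)
    have "frag_of a \<otimes>\<^bsub>A s\<^esub> frag_of b \<in> carrier (A s)" using s by (simp add: R.frag_of_closed)
    \<comment> \<open>Alternation depends only on the index of a letter, so a letter may be
      exchanged for any other non-unit one of the same A_s.\<close>
    moreover have "w @ (s, c) # z \<in> W" if "c \<in> basis (A s)" "c \<noteq> unit_index (A s)" for c
      using snoc.prems that s by (auto simp: p v alternating_words_append alternating_words_Cons)
    ultimately show ?thesis
      unfolding v p word_mult_letters[OF s(1-3)] using snoc.IH[OF s(4,5)]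
      by (intro order_trans[OF keys_frag_extend] UN_least)
         (auto simp: R.carrier_iff split: if_splits)
  qed
qed

text \<open>The recursion consumes \<open>u\<close> from its last letter, whereas the action of
  letters needs the first letter split off. The two ends do not interfere: the induction runs from
  the right and carries \<open>p\<close> along in front.\<close>

lemma word_mult_Cons:
  assumes "p # u \<in> W" "v \<in> W"
  shows "word_mult A (p # u) v = frag_extend (word_mult A [p]) (word_mult A u v)"
  using assms
proof (induction u arbitrary: v rule: rev_induct)
  case Nil
  then show ?case by (simp add: word_mult_Nil_left)
next
  case (snoc q w)
  obtain s a where q: "q = (s, a)" by force
  have pw: "p # w @ [q] \<in> W" "p # w \<in> W"
    using snoc.prems alternating_words_append[of "p # w" "[q]"] by auto
  \<comment> \<open>The letter \<open>p\<close> meets the head of \<open>w\<close> or, if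
    \<open>w\<close> is empty, \<open>(s, c)\<close>, which has the index of \<open>q\<close>.
    Neither interacts with \<open>p\<close>, since \<open>p # w @ [q]\<close> alternates.\<close>
  have hd: "word_mult A [p] (w @ (s, c) # z) = frag_of (p # w @ (s, c) # z)" for c z
    using pw by (subst word_mult_concat) (cases p; cases w; auto simp: q alternating_words_Cons)+
  show ?case
  proof (cases "v = [] \<or> fst (hd v) \<noteq> s")
    case True
    then have "word_mult A (p # w @ [q]) v = frag_of (p # w @ (s, a) # v)"
      "word_mult A (w @ [q]) v = frag_of (w @ (s, a) # v)"
      using word_mult_concat[of "p # w @ [q]" v] word_mult_concat[of "w @ [q]" v] by (auto simp: q)
    then show ?thesis by (simp add: hd)
  next
    case False
    then obtain b z where v: "v = (s, b) # z" by (metis list.exhaust_sel surjective_pairing)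
    have s: "s \<in> S" "a \<in> basis (A s)" "b \<in> basis (A s)" "z \<in> W"
      using snoc.prems alternating_words_append[of "p # w" "[q]"]
      by (auto simp: q v alternating_words_Cons)
    have "word_mult A (p # w @ [q]) v = word_mult A ((p # w) @ [(s, a)]) ((s, b) # z)"
      by (simp add: v q)
    also have "\<dots> = frag_extend (word_mult A [p]) (word_mult A (w @ [(s, a)]) ((s, b) # z))"
      unfolding word_mult_letters[OF s(1-3)] frag_extend_frag_extend
      using snoc.IH[OF pw(2) s(4)] by (intro frag_extend_eq) (simp add: hd)
    finally show ?thesis by (simp add: v q)
  qed
qed

section \<open>Associativity of the word product\<close>

lemma word_mult_prepend_left:
  assumes "s \<in> S" "a \<in> basis (A s)" "z \<in> W" "z = [] \<or> fst (hd z) \<noteq> s" "w \<in> W"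
  shows "word_mult A (prepend s z a) w = frag_extend (word_mult A (prepend s [] a)) (word_mult A z w)"
proof (cases "a = unit_index (A s)")
  case True
  have "word_mult A [] = frag_of" by (auto simp: word_mult_Nil_left)
  with True show ?thesis by (simp add: prepend_def frag_extend_frag_of_id)
next
  case False
  then show ?thesis using assms by (simp add: prepend_def word_mult_Cons alternating_words_Cons)
qed

text \<open>The letters of A_s form a representation of A_s on combinations of words. On a word
  \<open>prepend s z e\<close> this is the associativity of \<open>a\<close>, \<open>c\<close>,
  \<open>e\<close> in A_s, transported along \<open>prepend s z\<close>.\<close>

lemma word_mult_letter_action:
  assumes s: "s \<in> S" and ac: "a \<in> basis (A s)" "c \<in> basis (A s)" and y: "Poly_Mapping.keys y \<subseteq> W"
  shows "frag_extend (word_mult A (prepend s [] a)) (frag_extend (word_mult A (prepend s [] c)) y) =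
    frag_extend (\<lambda>d. frag_extend (word_mult A (prepend s [] d)) y) (frag_of a \<otimes>\<^bsub>A s\<^esub> frag_of c)"
  using y
proof (induction y rule: frag_induction)
  case zero
  then show ?case by (simp add: frag_extend_eq_0)
next
  case (one v)
  interpret R: based_ring "A s" using s by (rule based_ring_A)
  obtain z e where v: "v = prepend s z e" "e \<in> basis (A s)" "z \<in> W" "z = [] \<or> fst (hd z) \<noteq> s"
    using one s by (rule prepend_cases)
  note wm = word_mult_prepend[OF s _ _ v(4)]
  have cl: "frag_of a \<in> carrier (A s)" "frag_of c \<in> carrier (A s)" "frag_of e \<in> carrier (A s)"
    using ac v by (auto simp: R.frag_of_closed)
  have "frag_extend (word_mult A (prepend s [] a)) (word_mult A (prepend s [] c) v) =
      frag_extend (frag_of \<circ> prepend s z) (frag_of a \<otimes>\<^bsub>A s\<^esub> (frag_of c \<otimes>\<^bsub>A s\<^esub> frag_of e))"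
    using cl R.m_closed[OF cl(2,3)]
    by (subst R.mult_expand_right)
       (auto simp: v(1) wm ac v(2) frag_extend_frag_extend o_def R.carrier_iff subset_iff intro!: frag_extend_eq)
  also have "\<dots> = frag_extend (frag_of \<circ> prepend s z) (frag_of a \<otimes>\<^bsub>A s\<^esub> frag_of c \<otimes>\<^bsub>A s\<^esub> frag_of e)"
    using cl by (simp add: R.m_assoc)
  also have "\<dots> = frag_extend (\<lambda>d. word_mult A (prepend s [] d) v) (frag_of a \<otimes>\<^bsub>A s\<^esub> frag_of c)"
    using cl R.m_closed[OF cl(1,2)]
    by (subst R.mult_expand_left)
       (auto simp: v(1) wm ac v(2) frag_extend_frag_extend o_def R.carrier_iff subset_iff intro!: frag_extend_eq)
  finally show ?case by simp
next
  case (diff y z)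
  show ?case using diff by (simp add: frag_extend_diff frag_extend_fun_diff)
qed

text \<open>With \<open>v = prepend s z c\<close>, both sides become the action of
  \<open>a \<otimes> c\<close> on the product of \<open>z\<close> and \<open>w\<close>.\<close>

lemma word_mult_assoc_letter:
  assumes p: "[p] \<in> W" and v: "v \<in> W" and w: "w \<in> W"
  shows "frag_extend (\<lambda>x. word_mult A x w) (word_mult A [p] v) =
    frag_extend (word_mult A [p]) (word_mult A v w)"
proof -
  obtain s a where pa: "p = (s, a)" by force
  then have s: "s \<in> S" "a \<in> basis (A s)" and p': "[p] = prepend s [] a"
    using p by (auto simp: alternating_words_Cons prepend_def)
  interpret R: based_ring "A s" using s(1) by (rule based_ring_A)
  obtain z c where v: "v = prepend s z c" "c \<in> basis (A s)" "z \<in> W" "z = [] \<or> fst (hd z) \<noteq> s"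
    using v s(1) by (rule prepend_cases)
  have cl: "frag_of a \<otimes>\<^bsub>A s\<^esub> frag_of c \<in> carrier (A s)"
    using s v by (auto simp: R.frag_of_closed)
  have "frag_extend (\<lambda>x. word_mult A x w) (word_mult A [p] v) =
      frag_extend (\<lambda>d. word_mult A (prepend s z d) w) (frag_of a \<otimes>\<^bsub>A s\<^esub> frag_of c)"
    unfolding p' v(1) word_mult_prepend[OF s v(2,4)] by (simp add: frag_extend_frag_extend)
  also have "\<dots> = frag_extend (\<lambda>d. frag_extend (word_mult A (prepend s [] d)) (word_mult A z w))
      (frag_of a \<otimes>\<^bsub>A s\<^esub> frag_of c)"
    using cl by (intro frag_extend_eq word_mult_prepend_left s v w) (auto simp: R.carrier_iff)
  also have "\<dots> = frag_extend (word_mult A [p]) (word_mult A v w)"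
    unfolding p' v(1) word_mult_prepend_left[OF s(1) v(2,3,4) w]
    by (rule word_mult_letter_action[symmetric, OF s v(2) keys_word_mult[OF v(3) w]])
  finally show ?thesis .
qed

lemma word_mult_assoc:
  assumes "u \<in> W" and v: "v \<in> W" and w: "w \<in> W"
  shows "frag_extend (\<lambda>x. word_mult A x w) (word_mult A u v) =
    frag_extend (word_mult A u) (word_mult A v w)"
  using assms(1)
proof (induction u)
  case Nil
  have "word_mult A [] = frag_of" by (auto simp: word_mult_Nil_left)
  then show ?case by (simp add: frag_extend_frag_of_id)
next
  case (Cons p u)
  have p: "[p] \<in> W" and u: "u \<in> W"
    using Cons.prems by (cases p; auto simp: alternating_words_Cons alternating_words_Nil)+
  note keys = keys_word_mult[OF u v] keys_word_mult[OF v w]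
  have "frag_extend (\<lambda>x. word_mult A x w) (word_mult A (p # u) v) =
      frag_extend (\<lambda>y. frag_extend (\<lambda>x. word_mult A x w) (word_mult A [p] y)) (word_mult A u v)"
    using Cons.prems v by (simp add: word_mult_Cons frag_extend_frag_extend)
  also have "\<dots> = frag_extend (\<lambda>y. frag_extend (word_mult A [p]) (word_mult A y w)) (word_mult A u v)"
    using keys by (intro frag_extend_eq word_mult_assoc_letter p w) auto
  also have "\<dots> = frag_extend (word_mult A [p]) (frag_extend (word_mult A u) (word_mult A v w))"
    using Cons.IH[OF u] by (simp add: frag_extend_frag_extend[symmetric])
  also have "\<dots> = frag_extend (word_mult A (p # u)) (word_mult A v w)"
    unfolding frag_extend_frag_extend using keys Cons.prems
    by (intro frag_extend_eq) (auto simp: word_mult_Cons)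
  finally show ?case .
qed

section \<open>Ring structure of the free product\<close>

lemma free_product_simps:
  "basis fp = W" "unit_index fp = []" "conj_index fp = word_conj A"
  "\<zero>\<^bsub>fp\<^esub> = 0" "\<one>\<^bsub>fp\<^esub> = frag_of []" "add fp = (+)"
  "x \<otimes>\<^bsub>fp\<^esub> y = frag_extend (\<lambda>u. frag_extend (word_mult A u) y) x"
  by (simp_all add: free_product_def)

lemma free_product_carrier: "x \<in> carrier fp \<longleftrightarrow> Poly_Mapping.keys x \<subseteq> W"
  by (simp add: free_product_def free_Abelian_group_def)

lemma word_mult_assoc_frag:
  assumes "u \<in> W" "v \<in> W" "Poly_Mapping.keys z \<subseteq> W"
  shows "frag_extend (\<lambda>t. frag_extend (word_mult A t) z) (word_mult A u v) =
    frag_extend (word_mult A u) (frag_extend (word_mult A v) z)"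
  using assms(3)
proof (induction z rule: frag_induction)
  case (one w)
  then show ?case using word_mult_assoc[OF assms(1,2)] by simp
qed (simp_all add: frag_extend_eq_0 frag_extend_diff frag_extend_fun_diff)

lemma ring_free_product: "Ring.ring fp"
proof (rule ringI)
  show "abelian_group fp"
  proof (rule abelian_groupI)
    show "\<exists>y\<in>carrier fp. y \<oplus>\<^bsub>fp\<^esub> x = \<zero>\<^bsub>fp\<^esub>" if "x \<in> carrier fp" for x
      using that by (intro bexI[of _ "- x"]) (auto simp: free_product_carrier free_product_simps)
    show "x \<oplus>\<^bsub>fp\<^esub> y \<in> carrier fp" if "x \<in> carrier fp" "y \<in> carrier fp" for x y
      using that keys_add[of x y] by (auto simp: free_product_carrier free_product_simps)
  qed (auto simp: free_product_carrier free_product_simps algebra_simps)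
  show "monoid fp"
  proof (rule monoidI)
    fix x y z assume xyz: "x \<in> carrier fp" "y \<in> carrier fp" "z \<in> carrier fp"
    have *: "frag_extend (\<lambda>t. frag_extend (word_mult A t) z) (frag_extend (word_mult A u) y) =
        frag_extend (word_mult A u) (frag_extend (\<lambda>v. frag_extend (word_mult A v) z) y)" if "u \<in> W" for u
      unfolding frag_extend_frag_extend[of _ _ y] using xyz that
      by (intro frag_extend_eq word_mult_assoc_frag) (auto simp: free_product_carrier)
    show "x \<otimes>\<^bsub>fp\<^esub> y \<otimes>\<^bsub>fp\<^esub> z = x \<otimes>\<^bsub>fp\<^esub> (y \<otimes>\<^bsub>fp\<^esub> z)"
      unfolding free_product_simps frag_extend_frag_extend[of _ _ x] using xyz
      by (intro frag_extend_eq *) (auto simp: free_product_carrier)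
    show "x \<otimes>\<^bsub>fp\<^esub> y \<in> carrier fp"
      unfolding free_product_simps free_product_carrier using xyz
      by (intro order_trans[OF keys_frag_extend] UN_least keys_word_mult) (auto simp: free_product_carrier)
  next
    fix x assume "x \<in> carrier fp"
    have "word_mult A [] = frag_of" by (auto simp: word_mult_Nil_left)
    then show "\<one>\<^bsub>fp\<^esub> \<otimes>\<^bsub>fp\<^esub> x = x" by (simp add: free_product_simps frag_extend_frag_of_id)
    show "x \<otimes>\<^bsub>fp\<^esub> \<one>\<^bsub>fp\<^esub> = x" by (simp add: free_product_simps word_mult_Nil_right frag_extend_frag_of_id)
  qed (simp add: free_product_simps free_product_carrier alternating_words_Nil)
qed (simp_all add: free_product_simps frag_extend_add frag_extend_fun_add)

section \<open>Involution, trace and positivity on words\<close>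

lemma word_conj_simps:
  "word_conj A [] = []" "word_conj A (u @ v) = word_conj A v @ word_conj A u"
  "word_conj A ((s, a) # u) = word_conj A u @ [(s, conj_index (A s) a)]"
  by (simp_all add: word_conj_def)

lemma conj_index_eq_unit_iff:
  assumes "s \<in> S" "a \<in> basis (A s)"
  shows "conj_index (A s) a = unit_index (A s) \<longleftrightarrow> a = unit_index (A s)"
proof -
  interpret R: based_ring "A s" using assms(1) by (rule based_ring_A)
  show ?thesis using assms R.conj_index_conj_index R.conj_index_unit by metis
qed

lemma fst_last_word_conj: "w \<noteq> [] \<Longrightarrow> fst (last (word_conj A w)) = fst (hd w)"
  by (cases w) (auto simp: word_conj_simps)

lemma word_conj_eq_Nil: "word_conj A w = [] \<longleftrightarrow> w = []"
  by (simp add: word_conj_def)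

lemma word_conj_in_words: "w \<in> W \<Longrightarrow> word_conj A w \<in> W"
proof (induction w)
  case (Cons p w)
  obtain s a where p: "p = (s, a)" by force
  then have "s \<in> S" "a \<in> basis (A s)" "a \<noteq> unit_index (A s)" "w \<in> W" "w = [] \<or> fst (hd w) \<noteq> s"
    using Cons.prems by (auto simp: alternating_words_Cons)
  then show ?case
    using Cons.IH based_ring.conj_index_in_basis[OF based_ring_A] fst_last_word_conj[of w]
    by (auto simp: p word_conj_simps alternating_words_append alternating_words_Cons
        alternating_words_Nil conj_index_eq_unit_iff word_conj_eq_Nil)
qed (simp add: word_conj_simps alternating_words_Nil)

lemma word_conj_word_conj: "w \<in> W \<Longrightarrow> word_conj A (word_conj A w) = w"
proof (induction w)
  case (Cons p w)
  then show ?case using based_ring.conj_index_conj_index[OF based_ring_A]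
    by (cases p) (auto simp: word_conj_simps alternating_words_Cons)
qed (simp add: word_conj_simps)

text \<open>Letters interact only at the junction of \<open>u\<close> and \<open>v\<close>, which
  conjugation mirrors. There the antimultiplicativity of A_s applies; the unit summand is the
  induction hypothesis.\<close>

lemma bar_word_mult:
  assumes "u \<in> W" "v \<in> W"
  shows "bar fp (word_mult A u v) = word_mult A (word_conj A v) (word_conj A u)"
  using assms
proof (induction u arbitrary: v rule: rev_induct)
  case Nil
  then show ?case
    by (simp add: word_mult_Nil_left word_mult_Nil_right word_conj_simps bar_def free_product_simps)
next
  case (snoc p w)
  obtain s a where p: "p = (s, a)" by force
  show ?case
  proof (cases "v = [] \<or> fst (hd v) \<noteq> s")
    case True
    then have "word_mult A (w @ [p]) v = frag_of (w @ [p] @ v)"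
      by (subst word_mult_concat) (auto simp: p)
    moreover have "word_mult A (word_conj A v) (word_conj A (w @ [p])) = frag_of (word_conj A v @ word_conj A (w @ [p]))"
      using True fst_last_word_conj[of v]
      by (intro word_mult_concat) (auto simp: p word_conj_simps word_conj_eq_Nil)
    ultimately show ?thesis by (simp add: bar_def free_product_simps word_conj_simps p)
  next
    case False
    then obtain b z where v: "v = (s, b) # z" by (metis list.exhaust_sel surjective_pairing)
    have s: "s \<in> S" "a \<in> basis (A s)" "b \<in> basis (A s)" "w \<in> W" "z \<in> W"
      using snoc.prems by (auto simp: p v alternating_words_append alternating_words_Cons)
    interpret R: based_ring "A s" using s(1) by (rule based_ring_A)
    have ab: "frag_of a \<otimes>\<^bsub>A s\<^esub> frag_of b \<in> carrier (A s)" using s by (simp add: R.frag_of_closed)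
    let ?a = "conj_index (A s) a" and ?b = "conj_index (A s) b"
    have c: "?a \<in> basis (A s)" "?b \<in> basis (A s)" using s by (simp_all add: R.conj_index_in_basis)
    have "word_mult A (word_conj A v) (word_conj A (w @ [p])) =
        word_mult A (word_conj A z @ [(s, ?b)]) ((s, ?a) # word_conj A w)"
      by (simp add: v p word_conj_simps)
    also have "\<dots> = frag_extend (\<lambda>c. if c = unit_index (A s) then word_mult A (word_conj A z) (word_conj A w)
        else frag_of (word_conj A z @ (s, c) # word_conj A w)) (bar (A s) (frag_of a \<otimes>\<^bsub>A s\<^esub> frag_of b))"
      using s by (simp add: word_mult_letters[OF s(1) c(2,1)] R.bar_mult R.bar_frag_of)
    also have "\<dots> = bar fp (word_mult A (w @ [(s, a)]) ((s, b) # z))"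
      unfolding word_mult_letters[OF s(1-3)] unfolding bar_def frag_extend_frag_extend
      using snoc.IH[OF s(4,5)] ab s(1)
      by (intro frag_extend_eq)
         (auto simp: bar_def free_product_simps word_conj_simps conj_index_eq_unit_iff R.carrier_iff subset_iff)
    finally show ?thesis by (simp add: p v)
  qed
qed

text \<open>The empty word arises only if the letters at the junction cancel to the unit again and
  again until nothing is left. Each cancellation needs conjugate letters and then has coefficient
  1.\<close>

lemma lookup_word_mult_Nil:
  assumes "u \<in> W" "v \<in> W"
  shows "Poly_Mapping.lookup (word_mult A u v) [] = (if v = word_conj A u then 1 else 0)"
  using assms
proof (induction u arbitrary: v rule: rev_induct)
  case Nil
  then show ?case by (auto simp: word_mult_Nil_left word_conj_simps)
next
  case (snoc p w)
  obtain s a where p: "p = (s, a)" by force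
  show ?case
  proof (cases "v = [] \<or> fst (hd v) \<noteq> s")
    case True
    then show ?thesis by (subst word_mult_concat) (auto simp: p word_conj_simps)
  next
    case False
    then obtain b z where v: "v = (s, b) # z" by (metis list.exhaust_sel surjective_pairing)
    have s: "s \<in> S" "a \<in> basis (A s)" "b \<in> basis (A s)" "w \<in> W" "z \<in> W"
      using snoc.prems by (auto simp: p v alternating_words_append alternating_words_Cons)
    interpret R: based_ring "A s" using s(1) by (rule based_ring_A)
    let ?x = "frag_of a \<otimes>\<^bsub>A s\<^esub> frag_of b" and ?k = "Poly_Mapping.lookup (word_mult A w z) []"
    have "Poly_Mapping.lookup (word_mult A (w @ [(s, a)]) ((s, b) # z)) [] =
        (\<Sum>c\<in>Poly_Mapping.keys ?x. if c = unit_index (A s) then Poly_Mapping.lookup ?x c * ?k else 0)"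
      unfolding word_mult_letters[OF s(1-3)] lookup_frag_extend by (intro sum.cong) auto
    also have "\<dots> = Poly_Mapping.lookup ?x (unit_index (A s)) * ?k"
      by (simp add: in_keys_iff)
    finally show ?thesis
      using snoc.IH[OF s(4,5)] s by (simp add: R.lookup_mult_unit_index p v word_conj_simps)
  qed
qed

lemma frag_nonneg_word_mult:
  assumes "u \<in> W" "v \<in> W"
  shows "frag_nonneg (word_mult A u v)"
  using assms
proof (induction u arbitrary: v rule: rev_induct)
  case Nil
  then show ?case by (auto simp: word_mult_Nil_left frag_nonneg_of)
next
  case (snoc p w)
  obtain s a where p: "p = (s, a)" by force
  show ?case
  proof (cases "v = [] \<or> fst (hd v) \<noteq> s")
    case True
    then show ?thesis by (subst word_mult_concat) (auto simp: p frag_nonneg_of)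
  next
    case False
    then obtain b z where v: "v = (s, b) # z" by (metis list.exhaust_sel surjective_pairing)
    have s: "s \<in> S" "a \<in> basis (A s)" "b \<in> basis (A s)" "w \<in> W" "z \<in> W"
      using snoc.prems by (auto simp: p v alternating_words_append alternating_words_Cons)
    show ?thesis
      unfolding p v word_mult_letters[OF s(1-3)]
      using snoc.IH[OF s(4,5)] based_ring.frag_nonneg_mult_basis[OF based_ring_A s(2,3)] s(1)
      by (auto intro!: frag_nonneg_extend simp: frag_nonneg_of)
  qed
qed

lemma based_ring_free_product: "based_ring fp"
proof (intro based_ring.intro based_ring_axioms.intro ring_free_product)
  fix a b assume ab: "a \<in> basis fp" "b \<in> basis fp"
  then show "bar fp (frag_of a \<otimes>\<^bsub>fp\<^esub> frag_of b) = bar fp (frag_of b) \<otimes>\<^bsub>fp\<^esub> bar fp (frag_of a)"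
    using bar_word_mult[of a b] by (simp add: free_product_simps bar_def)
  show "tau fp (bar fp (frag_of a) \<otimes>\<^bsub>fp\<^esub> frag_of b) = (if a = b then 1 else 0)"
    using ab lookup_word_mult_Nil[of "word_conj A a" b] word_conj_word_conj[of a]
    by (auto simp: free_product_simps bar_def tau_def word_conj_in_words)
  fix c assume c: "c \<in> basis fp"
  have "frag_nonneg (frag_extend (\<lambda>u. word_mult A u c) (word_mult A a b))"
    using ab c keys_word_mult[of a b]
    by (intro frag_nonneg_extend frag_nonneg_word_mult) (auto simp: free_product_simps)
  then show "0 \<le> tau fp (frag_of a \<otimes>\<^bsub>fp\<^esub> frag_of b \<otimes>\<^bsub>fp\<^esub> frag_of c)"
    by (simp add: free_product_simps tau_def frag_nonneg_def)
qed (auto simp: free_product_simps alternating_words_Nil word_conj_in_words word_conj_word_conj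
      word_conj_simps free_product_def)

end

sublocale based_ring_family \<subseteq> fp: based_ring "free_product S A"
  by (rule based_ring_free_product)

section \<open>Dimension function of the free product\<close>

locale fusion_ring_family =
  fixes S :: "'s set" and A :: "'s \<Rightarrow> ('i, 'm) based_ring_data_scheme"
    and d :: "'s \<Rightarrow> ('i \<Rightarrow>\<^sub>0 int) \<Rightarrow> real"
  assumes based_ring_A': "s \<in> S \<Longrightarrow> based_ring (A s)"
    and dimension_function_A: "s \<in> S \<Longrightarrow> dimension_function (A s) (d s)"

sublocale fusion_ring_family \<subseteq> based_ring_family
  by (rule based_ring_family.intro) (rule based_ring_A')

context fusion_ring_family
begin

definition word_dim :: "('s \<times> 'i) list \<Rightarrow> real"
  where "word_dim w = prod_list (map (\<lambda>(s, a). d s (frag_of a)) w)"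

definition fp_dim :: "(('s \<times> 'i) list \<Rightarrow>\<^sub>0 int) \<Rightarrow> real"
  where "fp_dim = real_extend word_dim"

lemma word_dim_simps:
  "word_dim [] = 1" "word_dim ((s, a) # w) = d s (frag_of a) * word_dim w"
  "word_dim (u @ v) = word_dim u * word_dim v"
  by (simp_all add: word_dim_def)

text \<open>Since the unit of A_s has dimension 1, every summand \<open>c\<close> at the junction,
  the deleted unit included, has dimension that of \<open>w\<close> times that of \<open>z\<close>
  times \<open>d s (frag_of c)\<close>. Summing gives \<open>d s\<close> of a product in A_s, which
  is multiplicative.\<close>

lemma word_dim_mult:
  assumes "u \<in> W" "v \<in> W"
  shows "fp_dim (word_mult A u v) = word_dim u * word_dim v"
  using assms
proof (induction u arbitrary: v rule: rev_induct)
  case Nil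
  then show ?case by (auto simp: word_mult_Nil_left fp_dim_def word_dim_simps)
next
  case (snoc p w)
  obtain s a where p: "p = (s, a)" by force
  show ?case
  proof (cases "v = [] \<or> fst (hd v) \<noteq> s")
    case True
    then show ?thesis by (subst word_mult_concat) (auto simp: p fp_dim_def word_dim_simps)
  next
    case False
    then obtain b z where v: "v = (s, b) # z" by (metis list.exhaust_sel surjective_pairing)
    have s: "s \<in> S" "a \<in> basis (A s)" "b \<in> basis (A s)" "w \<in> W" "z \<in> W"
      using snoc.prems by (auto simp: p v alternating_words_append alternating_words_Cons)
    interpret R: based_ring "A s" using s(1) by (rule based_ring_A)
    note d = dimension_function_A[OF s(1)]
    have ab: "frag_of a \<in> carrier (A s)" "frag_of b \<in> carrier (A s)" using s by (simp_all add: R.frag_of_closed)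
    have "fp_dim (word_mult A (w @ [(s, a)]) ((s, b) # z)) =
        real_extend (\<lambda>c. word_dim w * word_dim z * d s (frag_of c)) (frag_of a \<otimes>\<^bsub>A s\<^esub> frag_of b)"
      unfolding word_mult_letters[OF s(1-3)] fp_dim_def real_extend_frag_extend
      using snoc.IH[OF s(4,5)]
      by (intro real_extend_cong) (auto simp: fp_dim_def word_dim_simps R.dimension_function_one[OF d])
    also have "\<dots> = word_dim w * word_dim z * d s (frag_of a \<otimes>\<^bsub>A s\<^esub> frag_of b)"
      using R.dimension_function_extend[OF d R.m_closed[OF ab]] by (simp add: real_extend_scale)
    finally show ?thesis
      by (simp add: p v word_dim_simps R.dimension_function_mult[OF d ab])
  qed
qed

lemma word_dim_conj: "w \<in> W \<Longrightarrow> word_dim (word_conj A w) = word_dim w"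
proof (induction w)
  case (Cons p w)
  obtain s a where p: "p = (s, a)" by force
  then have s: "s \<in> S" "a \<in> basis (A s)" "w \<in> W" using Cons.prems by (auto simp: alternating_words_Cons)
  interpret R: based_ring "A s" using s(1) by (rule based_ring_A)
  have "d s (frag_of (conj_index (A s) a)) = d s (frag_of a)"
    using R.dimension_function_bar[OF dimension_function_A[OF s(1)] R.frag_of_closed[OF s(2)]]
    by (simp add: R.bar_frag_of)
  then show ?case using Cons.IH[OF s(3)] by (simp add: p word_conj_simps word_dim_simps)
qed (simp add: word_conj_simps)

lemma word_dim_pos: "w \<in> W \<Longrightarrow> word_dim w > 0"
proof (induction w)
  case (Cons p w)
  obtain s a where p: "p = (s, a)" by force
  then have "s \<in> S" "a \<in> basis (A s)" "w \<in> W" using Cons.prems by (auto simp: alternating_words_Cons)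
  moreover from this have "d s (frag_of a) > 0"
    using dimension_function_A[of s] unfolding dimension_function_def by blast
  ultimately show ?case using Cons.IH by (simp add: p word_dim_simps)
qed (simp add: word_dim_simps)

lemma dimension_function_free_product: "dimension_function fp fp_dim"
proof -
  have "fp_dim (x \<otimes>\<^bsub>fp\<^esub> y) = fp_dim x * fp_dim y" if "x \<in> carrier fp" "y \<in> carrier fp" for x y
  proof -
    have "fp_dim (frag_extend (word_mult A u) y) = word_dim u * fp_dim y" if "u \<in> W" for u
      unfolding fp_dim_def real_extend_frag_extend real_extend_scale[symmetric]
      using that \<open>y \<in> carrier fp\<close> word_dim_mult[of u]
      by (intro real_extend_cong) (auto simp: fp_dim_def free_product_carrier)
    then have "fp_dim (x \<otimes>\<^bsub>fp\<^esub> y) = real_extend (\<lambda>u. fp_dim y * word_dim u) x"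
      unfolding free_product_simps using that
      by (subst fp_dim_def, subst real_extend_frag_extend)
         (auto simp: free_product_carrier fp_dim_def intro!: real_extend_cong)
    then show ?thesis by (simp add: real_extend_scale fp_dim_def)
  qed
  then have "fp_dim \<in> ring_hom fp real_ring"
    by (intro ring_hom_memI) (auto simp: real_ring_def free_product_simps fp_dim_def real_extend_add word_dim_simps)
  then show ?thesis
    by (auto simp: dimension_function_def free_product_simps fp_dim_def word_dim_pos bar_def word_dim_conj)
qed

lemma fusion_ring_free_product: "fusion_ring fp"
  using based_ring_free_product dimension_function_free_product
  by (auto intro!: fusion_ring.intro fusion_ring_axioms.intro)

end

section \<open>Based modules\<close>

context based_ring
begin

lemma lookup_bar:
  assumes "x \<in> carrier R" "c \<in> basis R"
  shows "Poly_Mapping.lookup (bar R x) c = Poly_Mapping.lookup x (conj_index R c)"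
proof -
  have "Poly_Mapping.lookup (bar R x) c =
      (\<Sum>a\<in>Poly_Mapping.keys x. if a = conj_index R c then Poly_Mapping.lookup x a else 0)"
    unfolding bar_def lookup_frag_extend using assms conj_index_conj_index
    by (intro sum.cong) (auto simp: carrier_iff subset_iff)
  then show ?thesis by (simp add: in_keys_iff)
qed

end

context cofinite_based_module
begin

lemma module_frag_of_closed: "b \<in> module_basis M \<Longrightarrow> frag_of b \<in> carrier M"
  by (simp add: module_carrier_iff)

lemma smult_diff_left:
  assumes "x \<in> carrier R" "y \<in> carrier R" "z \<in> carrier M"
  shows "(x - y) \<odot>\<^bsub>M\<^esub> z = x \<odot>\<^bsub>M\<^esub> z - y \<odot>\<^bsub>M\<^esub> z"
proof -
  have "(x - y \<oplus> y) \<odot>\<^bsub>M\<^esub> z = (x - y) \<odot>\<^bsub>M\<^esub> z \<oplus>\<^bsub>M\<^esub> y \<odot>\<^bsub>M\<^esub> z"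
    using assms minus_closed' by (intro smult_l_distr) auto
  then show ?thesis by (simp add: add_eq module_add_eq algebra_simps)
qed

lemma smult_diff_right:
  assumes "x \<in> carrier M" "y \<in> carrier M" "z \<in> carrier R"
  shows "z \<odot>\<^bsub>M\<^esub> (x - y) = z \<odot>\<^bsub>M\<^esub> x - z \<odot>\<^bsub>M\<^esub> y"
proof -
  have "z \<odot>\<^bsub>M\<^esub> (x - y \<oplus>\<^bsub>M\<^esub> y) = z \<odot>\<^bsub>M\<^esub> (x - y) \<oplus>\<^bsub>M\<^esub> z \<odot>\<^bsub>M\<^esub> y"
    using assms module_minus_closed by (intro smult_r_distr) auto
  then show ?thesis by (simp add: module_add_eq algebra_simps)
qed

lemma smult_expand_left:
  assumes "x \<in> carrier R" "y \<in> carrier M"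
  shows "x \<odot>\<^bsub>M\<^esub> y = frag_extend (\<lambda>a. frag_of a \<odot>\<^bsub>M\<^esub> y) x"
proof -
  have "Poly_Mapping.keys x \<subseteq> basis R" using assms by (simp add: carrier_iff)
  then have "x \<in> carrier R \<and> x \<odot>\<^bsub>M\<^esub> y = frag_extend (\<lambda>a. frag_of a \<odot>\<^bsub>M\<^esub> y) x"
  proof (induction rule: frag_induction)
    case zero
    have "0 \<in> carrier R" by (simp add: carrier_iff)
    then show ?case using smult_diff_left[of 0 0 y] assms(2) by simp
  next
    case (diff x z)
    then show ?case using assms(2) by (simp add: frag_extend_diff smult_diff_left minus_closed')
  qed (simp add: frag_of_closed)
  then show ?thesis by simp
qed

lemma smult_expand_right:
  assumes "x \<in> carrier R" "y \<in> carrier M"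
  shows "x \<odot>\<^bsub>M\<^esub> y = frag_extend (\<lambda>b. x \<odot>\<^bsub>M\<^esub> frag_of b) y"
proof -
  have "Poly_Mapping.keys y \<subseteq> module_basis M" using assms by (simp add: module_carrier_iff)
  then have "y \<in> carrier M \<and> x \<odot>\<^bsub>M\<^esub> y = frag_extend (\<lambda>b. x \<odot>\<^bsub>M\<^esub> frag_of b) y"
  proof (induction rule: frag_induction)
    case zero
    have "0 \<in> carrier M" by (simp add: module_carrier_iff)
    then show ?case using smult_diff_right[of 0 0 x] assms(1) by simp
  next
    case (diff y z)
    then show ?case using assms(1) by (simp add: frag_extend_diff smult_diff_right module_minus_closed)
  qed (simp add: module_frag_of_closed)
  then show ?thesis by simp
qed

lemma smult_basis_closed:
  assumes "a \<in> basis R" "b \<in> module_basis M"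
  shows "frag_of a \<odot>\<^bsub>M\<^esub> frag_of b \<in> carrier M"
  using assms by (intro smult_closed frag_of_closed module_frag_of_closed)

text \<open>The form encodes the structure constants of the module: both sides are the trace of
  \<open>a\<close> times the form of \<open>b\<close> and \<open>c\<close>.\<close>

lemma lookup_form:
  assumes "a \<in> basis R" "b \<in> module_basis M" "c \<in> module_basis M"
  shows "Poly_Mapping.lookup (form M (frag_of b) (frag_of c)) (conj_index R a) =
    Poly_Mapping.lookup (frag_of a \<odot>\<^bsub>M\<^esub> frag_of b) c"
proof -
  have "frag_of a = bar R (frag_of (conj_index R a))"
    using assms by (simp add: bar_frag_of conj_index_conj_index)
  then show ?thesis
    using module_const_lookup[OF assms] assms
      tau_bar_mult'[of "form M (frag_of b) (frag_of c)" "conj_index R a"]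
    by (simp add: module_const_def form_closed module_frag_of_closed conj_index_in_basis)
qed

text \<open>Frobenius reciprocity for the module, from the hermitian symmetry of the form.\<close>

lemma lookup_smult_conj:
  assumes "a \<in> basis R" "b \<in> module_basis M" "c \<in> module_basis M"
  shows "Poly_Mapping.lookup (frag_of (conj_index R a) \<odot>\<^bsub>M\<^esub> frag_of c) b =
    Poly_Mapping.lookup (frag_of a \<odot>\<^bsub>M\<^esub> frag_of b) c"
  using lookup_form[of "conj_index R a" c b] lookup_form[OF assms] assms
    lookup_bar[of "form M (frag_of b) (frag_of c)" a] form_bar[of c b]
  by (simp add: conj_index_conj_index conj_index_in_basis form_closed module_frag_of_closed)

lemma frag_nonneg_smult:
  assumes "a \<in> basis R" "b \<in> module_basis M"
  shows "frag_nonneg (frag_of a \<odot>\<^bsub>M\<^esub> frag_of b)"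
  unfolding frag_nonneg_def
proof
  fix c
  show "0 \<le> Poly_Mapping.lookup (frag_of a \<odot>\<^bsub>M\<^esub> frag_of b) c"
  proof (cases "c \<in> module_basis M")
    case True
    then show ?thesis
      using module_const_lookup[OF assms True] tau_mult_form_nonneg[OF assms True]
      by (simp add: module_const_def)
  next
    case False
    then have "c \<notin> Poly_Mapping.keys (frag_of a \<odot>\<^bsub>M\<^esub> frag_of b)"
      using smult_basis_closed[OF assms] by (auto simp: module_carrier_iff)
    then show ?thesis by (simp add: in_keys_iff)
  qed
qed

lemma frag_nonneg_form:
  assumes "b \<in> module_basis M" "c \<in> module_basis M"
  shows "frag_nonneg (form M (frag_of b) (frag_of c))"
  unfolding frag_nonneg_def
proof
  fix a
  have cl: "form M (frag_of b) (frag_of c) \<in> carrier R"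
    using assms by (simp add: form_closed module_frag_of_closed)
  show "0 \<le> Poly_Mapping.lookup (form M (frag_of b) (frag_of c)) a"
  proof (cases "a \<in> basis R")
    case True
    then show ?thesis
      using lookup_form[of "conj_index R a" b c] assms frag_nonneg_smult[of "conj_index R a" b]
      by (simp add: conj_index_conj_index conj_index_in_basis frag_nonneg_def)
  next
    case False
    then have "a \<notin> Poly_Mapping.keys (form M (frag_of b) (frag_of c))"
      using cl by (auto simp: carrier_iff)
    then show ?thesis by (simp add: in_keys_iff)
  qed
qed

section \<open>Constituents of products in a module\<close>

definition occurs :: "'i \<Rightarrow> 'j \<Rightarrow> 'j \<Rightarrow> bool"
  where "occurs a b c \<longleftrightarrow> Poly_Mapping.lookup (frag_of a \<odot>\<^bsub>M\<^esub> frag_of b) c \<noteq> 0"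

lemma occurs_in_basis: "\<lbrakk>occurs a b c; a \<in> basis R; b \<in> module_basis M\<rbrakk> \<Longrightarrow> c \<in> module_basis M"
  using smult_basis_closed[of a b] by (auto simp: occurs_def module_carrier_iff in_keys_iff)

lemma occurs_conj:
  "\<lbrakk>a \<in> basis R; b \<in> module_basis M; c \<in> module_basis M\<rbrakk> \<Longrightarrow> occurs (conj_index R a) c b \<longleftrightarrow> occurs a b c"
  by (simp add: occurs_def lookup_smult_conj)

lemma occurs_unit_index: "b \<in> module_basis M \<Longrightarrow> occurs (unit_index R) b c \<longleftrightarrow> c = b"
  using smult_one[of "frag_of b"] by (simp add: occurs_def one_eq module_frag_of_closed)

text \<open>Both sides say that \<open>c\<close> is a constituent of
  \<open>a \<otimes> a' \<otimes> b\<close>, bracketed in the two ways; nonnegativity excludes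
  cancellation.\<close>

lemma occurs_mult:
  assumes "a \<in> basis R" "a' \<in> basis R" "b \<in> module_basis M"
  shows "(\<exists>e. Poly_Mapping.lookup (frag_of a \<otimes> frag_of a') e \<noteq> 0 \<and> occurs e b c) \<longleftrightarrow>
    (\<exists>x. occurs a' b x \<and> occurs a x c)"
proof -
  have cl: "frag_of a \<otimes> frag_of a' \<in> carrier R" "frag_of a' \<odot>\<^bsub>M\<^esub> frag_of b \<in> carrier M"
    using assms by (auto simp: frag_of_closed smult_basis_closed)
  have "(\<exists>e. Poly_Mapping.lookup (frag_of a \<otimes> frag_of a') e \<noteq> 0 \<and> occurs e b c) \<longleftrightarrow>
      Poly_Mapping.lookup (frag_of a \<otimes> frag_of a' \<odot>\<^bsub>M\<^esub> frag_of b) c \<noteq> 0"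
    unfolding occurs_def using assms cl
    by (subst smult_expand_left, simp, simp add: module_frag_of_closed,
        subst lookup_frag_extend_neq_0_iff)
       (auto simp: frag_nonneg_mult_basis carrier_iff subset_iff intro!: frag_nonneg_smult)
  also have "frag_of a \<otimes> frag_of a' \<odot>\<^bsub>M\<^esub> frag_of b = frag_of a \<odot>\<^bsub>M\<^esub> (frag_of a' \<odot>\<^bsub>M\<^esub> frag_of b)"
    using assms by (simp add: smult_assoc frag_of_closed module_frag_of_closed)
  also have "Poly_Mapping.lookup \<dots> c \<noteq> 0 \<longleftrightarrow> (\<exists>x. occurs a' b x \<and> occurs a x c)"
    unfolding occurs_def using assms cl
    by (subst smult_expand_right, simp add: frag_of_closed, simp,
        subst lookup_frag_extend_neq_0_iff)
       (auto simp: module_carrier_iff subset_iff intro!: frag_nonneg_smult)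
  finally show ?thesis .
qed

text \<open>Only linearity in the first argument is given, so the second argument is treated after
  exchanging the two by \<open>form_bar\<close>. The remaining \<open>bar\<close> does no harm once
  a dimension function is applied.\<close>

lemma form_diag_smult:
  assumes "a \<in> basis R" "b \<in> module_basis M" "c \<in> module_basis M"
    and bc: "frag_of b = frag_of a \<odot>\<^bsub>M\<^esub> frag_of c"
  shows "form M (frag_of b) (frag_of b) = frag_of a \<otimes> bar R (frag_of a \<otimes> form M (frag_of c) (frag_of c))"
proof -
  have "form M (frag_of b) (frag_of b) = frag_of a \<otimes> form M (frag_of c) (frag_of b)"
    using form_smult[of a c b] assms by metis
  also have "form M (frag_of c) (frag_of b) = bar R (form M (frag_of b) (frag_of c))"
    using assms by (intro form_bar)
  also have "form M (frag_of b) (frag_of c) = frag_of a \<otimes> form M (frag_of c) (frag_of c)"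
    using form_smult[of a c c] assms by metis
  finally show ?thesis .
qed

end

section \<open>Restriction to a based subring\<close>

locale based_ring_embedding = R: based_ring R + Q: based_ring Q
  for R :: "('i, 'm) based_ring_data_scheme" and Q :: "('k, 'n) based_ring_data_scheme" +
  fixes j :: "'i \<Rightarrow> 'k"
  assumes j_in_basis: "a \<in> basis R \<Longrightarrow> j a \<in> basis Q"
    and j_inj: "inj_on j (basis R)"
    and j_unit: "j (unit_index R) = unit_index Q"
    and j_conj: "a \<in> basis R \<Longrightarrow> j (conj_index R a) = conj_index Q (j a)"
    and j_mult: "\<lbrakk>a \<in> basis R; b \<in> basis R\<rbrakk> \<Longrightarrow>
      frag_extend (frag_of \<circ> j) (frag_of a \<otimes>\<^bsub>R\<^esub> frag_of b) = frag_of (j a) \<otimes>\<^bsub>Q\<^esub> frag_of (j b)"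
begin

definition push :: "('i \<Rightarrow>\<^sub>0 int) \<Rightarrow> ('k \<Rightarrow>\<^sub>0 int)"
  where "push = frag_extend (frag_of \<circ> j)"

text \<open>The projection onto the span of the image of \<open>j\<close>, read back in
  \<open>R\<close>: coefficients outside the image are dropped. It supplies the form of a restricted
  module.\<close>

definition pull :: "('k \<Rightarrow>\<^sub>0 int) \<Rightarrow> ('i \<Rightarrow>\<^sub>0 int)"
  where "pull = frag_extend (\<lambda>u. if u \<in> j ` basis R then frag_of (inv_into (basis R) j u) else 0)"

lemma push_of [simp]: "push (frag_of a) = frag_of (j a)"
  by (simp add: push_def)

lemma push_closed: "x \<in> carrier R \<Longrightarrow> push x \<in> carrier Q"
  unfolding push_def by (rule Q.frag_extend_closed) (auto simp: R.carrier_iff Q.carrier_iff j_in_basis)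

lemma push_mult:
  assumes "x \<in> carrier R" "y \<in> carrier R"
  shows "push (x \<otimes>\<^bsub>R\<^esub> y) = push x \<otimes>\<^bsub>Q\<^esub> push y"
proof -
  have 1: "push (frag_of a \<otimes>\<^bsub>R\<^esub> y) = frag_of (j a) \<otimes>\<^bsub>Q\<^esub> push y" if a: "a \<in> basis R" for a
  proof -
    have "push (frag_of a \<otimes>\<^bsub>R\<^esub> y) = frag_extend (\<lambda>b. push (frag_of a \<otimes>\<^bsub>R\<^esub> frag_of b)) y"
      by (subst R.mult_expand_right) (use assms a in \<open>auto simp: R.frag_of_closed push_def frag_extend_frag_extend\<close>)
    also have "\<dots> = frag_extend (\<lambda>b. frag_of (j a) \<otimes>\<^bsub>Q\<^esub> frag_of (j b)) y"
      using assms a by (intro frag_extend_eq) (auto simp: push_def j_mult R.carrier_iff)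
    also have "\<dots> = frag_of (j a) \<otimes>\<^bsub>Q\<^esub> push y"
      using a push_closed[OF assms(2)]
      by (subst Q.mult_expand_right) (auto simp: Q.frag_of_closed j_in_basis push_def frag_extend_frag_extend o_def)
    finally show ?thesis .
  qed
  have "push (x \<otimes>\<^bsub>R\<^esub> y) = frag_extend (\<lambda>a. push (frag_of a \<otimes>\<^bsub>R\<^esub> y)) x"
    by (subst R.mult_expand_left) (use assms in \<open>auto simp: push_def frag_extend_frag_extend\<close>)
  also have "\<dots> = frag_extend (\<lambda>a. frag_of (j a) \<otimes>\<^bsub>Q\<^esub> push y) x"
    using assms by (intro frag_extend_eq) (auto simp: 1 R.carrier_iff)
  also have "\<dots> = push x \<otimes>\<^bsub>Q\<^esub> push y"
    using push_closed assms
    by (subst Q.mult_expand_left) (auto simp: push_def frag_extend_frag_extend o_def)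
  finally show ?thesis .
qed

lemma lookup_pull:
  "Poly_Mapping.lookup (pull y) a = (if a \<in> basis R then Poly_Mapping.lookup y (j a) else 0)"
proof -
  have "Poly_Mapping.lookup (pull y) a =
      (\<Sum>u\<in>Poly_Mapping.keys y. if u = j a then (if a \<in> basis R then Poly_Mapping.lookup y u else 0) else 0)"
    unfolding pull_def lookup_frag_extend using j_inj
    by (intro sum.cong) (auto simp: inv_into_f_f inj_on_eq_iff intro: inv_into_into)
  then show ?thesis by (simp add: in_keys_iff)
qed

lemma pull_closed: "pull y \<in> carrier R"
  by (auto simp: R.carrier_iff in_keys_iff lookup_pull split: if_splits)

lemma pull_add: "pull (x + y) = pull x + pull y"
  by (simp add: pull_def frag_extend_add)

lemma pull_bar: "y \<in> carrier Q \<Longrightarrow> pull (bar Q y) = bar R (pull y)"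
proof (rule poly_mapping_eqI)
  fix a assume y: "y \<in> carrier Q"
  have "bar R (pull y) \<in> carrier R" by (simp add: R.bar_closed pull_closed)
  then have "Poly_Mapping.lookup (bar R (pull y)) a = 0" if "a \<notin> basis R"
    using that by (auto simp: R.carrier_iff in_keys_iff)
  then show "Poly_Mapping.lookup (pull (bar Q y)) a = Poly_Mapping.lookup (bar R (pull y)) a"
    using y by (auto simp: lookup_pull R.lookup_bar Q.lookup_bar pull_closed j_in_basis j_conj R.conj_index_in_basis)
qed

text \<open>The adjunction between \<open>push\<close> and \<open>pull\<close> for the trace
  pairing. For a basis element \<open>e\<close> that is the conjugate of \<open>c\<close>, both
  sides are the coefficient of \<open>y\<close> at \<open>j c\<close>.\<close>

lemma tau_mult_push:
  assumes "y \<in> carrier Q" "z \<in> carrier R"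
  shows "tau Q (y \<otimes>\<^bsub>Q\<^esub> push z) = tau R (pull y \<otimes>\<^bsub>R\<^esub> z)"
proof -
  have "Poly_Mapping.keys z \<subseteq> basis R" using assms by (simp add: R.carrier_iff)
  then have "z \<in> carrier R \<and> tau Q (y \<otimes>\<^bsub>Q\<^esub> push z) = tau R (pull y \<otimes>\<^bsub>R\<^esub> z)"
  proof (induction rule: frag_induction)
    case zero
    then show ?case
      using R.r_null[OF pull_closed[of y]] Q.r_null[OF assms(1)] R.zero_closed
      by (simp add: push_def R.zero_eq Q.zero_eq tau_def)
  next
    case (one e)
    define c where "c = conj_index R e"
    have c: "c \<in> basis R" "frag_of e = bar R (frag_of c)" "frag_of (j e) = bar Q (frag_of (j c))"
      using one by (simp_all add: c_def R.bar_frag_of Q.bar_frag_of R.conj_index_in_basis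
          R.conj_index_conj_index flip: j_conj)
    have "tau Q (y \<otimes>\<^bsub>Q\<^esub> push (frag_of e)) = Poly_Mapping.lookup y (j c)"
      using c(3) Q.tau_mult_bar[OF assms(1) j_in_basis[OF c(1)]] by simp
    moreover have "tau R (pull y \<otimes>\<^bsub>R\<^esub> frag_of e) = Poly_Mapping.lookup y (j c)"
      using c(1,2) R.tau_mult_bar[OF pull_closed c(1)] by (simp add: lookup_pull)
    ultimately show ?case using one by (simp add: R.frag_of_closed)
  next
    case (diff x z)
    have "push (x - z) = push x - push z" by (simp add: push_def frag_extend_diff)
    then show ?case using diff assms(1)
      by (simp add: R.minus_closed' Q.mult_diff_right R.mult_diff_right push_closed pull_closed tau_diff)
  qed
  then show ?thesis by simp
qed

text \<open>As the adjoint of the ring homomorphism \<open>push\<close>, \<open>pull\<close> is \<open>R\<close>-linear.\<close>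

lemma pull_mult:
  assumes a: "a \<in> basis R" and y: "y \<in> carrier Q"
  shows "pull (frag_of (j a) \<otimes>\<^bsub>Q\<^esub> y) = frag_of a \<otimes>\<^bsub>R\<^esub> pull y"
proof (rule poly_mapping_eqI)
  fix c
  have cl: "frag_of a \<in> carrier R" "frag_of (j a) \<in> carrier Q"
    using a by (simp_all add: R.frag_of_closed Q.frag_of_closed j_in_basis)
  show "Poly_Mapping.lookup (pull (frag_of (j a) \<otimes>\<^bsub>Q\<^esub> y)) c = Poly_Mapping.lookup (frag_of a \<otimes>\<^bsub>R\<^esub> pull y) c"
  proof (cases "c \<in> basis R")
    case True
    let ?c = "bar R (frag_of c)"
    have c: "?c \<in> carrier R" "push ?c = bar Q (frag_of (j c))"
      using True by (simp_all add: R.frag_of_closed R.conj_index_in_basis Q.bar_frag_of R.bar_frag_of j_conj)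
    have c': "bar Q (frag_of (j c)) \<in> carrier Q" using c push_closed by metis
    have "Poly_Mapping.lookup (pull (frag_of (j a) \<otimes>\<^bsub>Q\<^esub> y)) c =
        tau Q (frag_of (j a) \<otimes>\<^bsub>Q\<^esub> y \<otimes>\<^bsub>Q\<^esub> push ?c)"
      using True cl y by (simp add: lookup_pull c Q.tau_mult_bar j_in_basis)
    \<comment> \<open>The trace property moves \<open>j a\<close> behind \<open>push ?c\<close>,
      where both merge into one value of \<open>push\<close> and the adjunction applies. The same
      move in \<open>R\<close> then restores the order.\<close>
    also have "\<dots> = tau Q (y \<otimes>\<^bsub>Q\<^esub> push (?c \<otimes>\<^bsub>R\<^esub> frag_of a))"
      using cl y c c' Q.tau_commute[of "frag_of (j a)" "y \<otimes>\<^bsub>Q\<^esub> push ?c"]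
      by (simp add: push_mult Q.m_assoc)
    also have "\<dots> = tau R (pull y \<otimes>\<^bsub>R\<^esub> (?c \<otimes>\<^bsub>R\<^esub> frag_of a))"
      using y c cl by (intro tau_mult_push) auto
    also have "\<dots> = tau R (frag_of a \<otimes>\<^bsub>R\<^esub> pull y \<otimes>\<^bsub>R\<^esub> ?c)"
      using cl c R.tau_commute[of "frag_of a" "pull y \<otimes>\<^bsub>R\<^esub> ?c"] pull_closed[of y]
      by (simp add: R.m_assoc)
    also have "\<dots> = Poly_Mapping.lookup (frag_of a \<otimes>\<^bsub>R\<^esub> pull y) c"
      using True cl pull_closed by (intro R.tau_mult_bar) auto
    finally show ?thesis .
  next
    case False
    moreover have "frag_of a \<otimes>\<^bsub>R\<^esub> pull y \<in> carrier R" using cl pull_closed by auto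
    ultimately show ?thesis by (auto simp: lookup_pull R.carrier_iff in_keys_iff)
  qed
qed

text \<open>Restriction of scalars along \<open>push\<close> to a stable part of the basis. The new
  form is \<open>pull\<close> of the old one; its axioms come from \<open>pull_mult\<close> and
  \<open>pull_bar\<close>.\<close>

lemma restrict_module:
  fixes M :: "('k, 'j, 'l) based_module_data_scheme"
  assumes "cofinite_based_module Q M"
    and B: "B \<subseteq> module_basis M"
    and B_closed: "\<And>a b. \<lbrakk>a \<in> basis R; b \<in> B\<rbrakk> \<Longrightarrow> Poly_Mapping.keys (frag_of (j a) \<odot>\<^bsub>M\<^esub> frag_of b) \<subseteq> B"
  obtains N :: "('i, 'j) based_module_data"
  where "cofinite_based_module R N" "module_basis N = B" "\<And>a x. a \<odot>\<^bsub>N\<^esub> x = push a \<odot>\<^bsub>M\<^esub> x"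
proof -
  interpret M: cofinite_based_module Q M by fact
  define N :: "('i, 'j) based_module_data" where
    "N = \<lparr>carrier = carrier (free_Abelian_group B), monoid.mult = undefined, one = undefined,
      ring.zero = 0, add = (+), smult = (\<lambda>a x. push a \<odot>\<^bsub>M\<^esub> x), module_basis = B,
      form = (\<lambda>x y. pull (form M x y))\<rparr>"
  have N_iff: "y \<in> carrier N \<longleftrightarrow> Poly_Mapping.keys y \<subseteq> B" for y
    by (simp add: N_def free_Abelian_group_def)
  have N_simps: "add N = (+)" "\<zero>\<^bsub>N\<^esub> = 0" "module_basis N = B"
    "\<And>a y. a \<odot>\<^bsub>N\<^esub> y = push a \<odot>\<^bsub>M\<^esub> y" "\<And>x y. form N x y = pull (form M x y)"
    by (simp_all add: N_def)
  have NM: "x \<in> carrier M" if "x \<in> carrier N" for x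
    using that B by (auto simp: N_iff M.module_carrier_iff)
  have ab: "abelian_group N"
  proof (rule abelian_groupI)
    show "\<exists>y\<in>carrier N. y \<oplus>\<^bsub>N\<^esub> x = \<zero>\<^bsub>N\<^esub>" if "x \<in> carrier N" for x
      using that by (intro bexI[of _ "- x"]) (auto simp: N_iff N_simps)
    show "x \<oplus>\<^bsub>N\<^esub> y \<in> carrier N" if "x \<in> carrier N" "y \<in> carrier N" for x y
      using that keys_add[of x y] by (auto simp: N_iff N_simps)
  qed (auto simp: N_iff N_simps algebra_simps)
  have lm: "left_module R N"
  proof (intro left_module.intro left_module_axioms.intro ab)
    show "Ring.ring R" by (rule R.ring_axioms)
  next
    fix a x assume a: "a \<in> carrier R" and x: "x \<in> carrier N"
    have *: "Poly_Mapping.keys (frag_of (j e) \<odot>\<^bsub>M\<^esub> x) \<subseteq> B" if "e \<in> basis R" for e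
      using that x NM[OF x] B_closed[OF that]
      by (subst M.smult_expand_right)
         (auto simp: Q.frag_of_closed j_in_basis N_iff dest!: subsetD[OF keys_frag_extend])
    have "push a \<odot>\<^bsub>M\<^esub> x = frag_extend (\<lambda>e. frag_of (j e) \<odot>\<^bsub>M\<^esub> x) a"
      using a x push_closed
      by (subst M.smult_expand_left) (auto simp: NM push_def frag_extend_frag_extend)
    then show "a \<odot>\<^bsub>N\<^esub> x \<in> carrier N"
      using a keys_frag_extend[of "\<lambda>e. frag_of (j e) \<odot>\<^bsub>M\<^esub> x" a] *
      by (auto simp: N_simps N_iff R.carrier_iff)
  next
    fix a b x assume "a \<in> carrier R" "b \<in> carrier R" "x \<in> carrier N"
    then show "(a \<oplus>\<^bsub>R\<^esub> b) \<odot>\<^bsub>N\<^esub> x = a \<odot>\<^bsub>N\<^esub> x \<oplus>\<^bsub>N\<^esub> b \<odot>\<^bsub>N\<^esub> x"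
      using M.smult_l_distr[of "push a" "push b" x]
      by (simp add: N_simps M.module_add_eq NM R.add_eq Q.add_eq push_closed)
         (simp add: push_def frag_extend_add)
  next
    fix a x y assume "a \<in> carrier R" "x \<in> carrier N" "y \<in> carrier N"
    then show "a \<odot>\<^bsub>N\<^esub> (x \<oplus>\<^bsub>N\<^esub> y) = a \<odot>\<^bsub>N\<^esub> x \<oplus>\<^bsub>N\<^esub> a \<odot>\<^bsub>N\<^esub> y"
      using M.smult_r_distr[of "push a" x y] by (simp add: N_simps M.module_add_eq NM push_closed)
  next
    fix a b x assume "a \<in> carrier R" "b \<in> carrier R" "x \<in> carrier N"
    then show "(a \<otimes>\<^bsub>R\<^esub> b) \<odot>\<^bsub>N\<^esub> x = a \<odot>\<^bsub>N\<^esub> (b \<odot>\<^bsub>N\<^esub> x)"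
      by (simp add: N_simps NM push_closed push_mult M.smult_assoc)
  next
    fix x assume "x \<in> carrier N"
    then show "\<one>\<^bsub>R\<^esub> \<odot>\<^bsub>N\<^esub> x = x"
      using M.smult_one[of x] by (simp add: N_simps NM R.one_eq Q.one_eq j_unit)
  qed
  have of_M: "frag_of b \<in> carrier M" if "b \<in> B" for b
    using that B by (auto simp: M.module_carrier_iff)
  have fc: "form M (frag_of b) (frag_of c) \<in> carrier Q" if "b \<in> B" "c \<in> B" for b c
    using that by (simp add: M.form_closed of_M)
  have N1: "cofinite_based_module R N"
  proof (intro cofinite_based_module.intro cofinite_based_module_axioms.intro lm)
    show "based_ring R" by (rule R.based_ring_axioms)
    show "carrier N = carrier (free_Abelian_group (module_basis N))" by (simp add: N_def)
    show "\<zero>\<^bsub>N\<^esub> = 0" "add N = (+)" by (simp_all add: N_simps)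
    show "form N x y \<in> carrier R" for x y by (simp add: N_simps pull_closed)
  next
    fix x y z assume "x \<in> carrier N" "y \<in> carrier N" "z \<in> carrier N"
    then show "form N (x \<oplus>\<^bsub>N\<^esub> y) z = form N x z \<oplus>\<^bsub>R\<^esub> form N y z"
      "form N x (y \<oplus>\<^bsub>N\<^esub> z) = form N x y \<oplus>\<^bsub>R\<^esub> form N x z"
      using M.form_add_left[of x y z] M.form_add_right[of x y z]
      by (simp_all add: N_simps M.module_add_eq NM R.add_eq Q.add_eq pull_add)
  next
    fix a b c assume "a \<in> basis R" "b \<in> module_basis N" "c \<in> module_basis N"
    then have abc: "a \<in> basis R" "b \<in> B" "c \<in> B" "b \<in> module_basis M" "c \<in> module_basis M"
      using B by (auto simp: N_simps)
    note pm = pull_mult[OF abc(1) fc[OF abc(2,3)]]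
    show "form N (frag_of a \<odot>\<^bsub>N\<^esub> frag_of b) (frag_of c) = frag_of a \<otimes>\<^bsub>R\<^esub> form N (frag_of b) (frag_of c)"
      using M.form_smult[of "j a" b c] abc by (simp add: N_simps j_in_basis flip: pm)
    have "tau R (pull x) = tau Q x" for x
      by (simp add: tau_def lookup_pull j_unit R.unit_index_in_basis)
    then show "0 \<le> tau R (frag_of a \<otimes>\<^bsub>R\<^esub> form N (frag_of b) (frag_of c))"
      using M.tau_mult_form_nonneg[of "j a" b c] abc by (simp add: N_simps j_in_basis flip: pm)
  next
    fix b c assume "b \<in> module_basis N" "c \<in> module_basis N"
    then have bc: "b \<in> B" "c \<in> B" "b \<in> module_basis M" "c \<in> module_basis M"
      using B by (auto simp: N_simps)
    show "form N (frag_of b) (frag_of c) = bar R (form N (frag_of c) (frag_of b))"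
      using M.form_bar[of b c] pull_bar[OF fc[of c b]] bc by (simp add: N_simps)
    show "tau R (form N (frag_of b) (frag_of c)) = (if b = c then 1 else 0)"
      using M.tau_form[of b c] bc
      by (simp add: N_simps tau_def lookup_pull j_unit R.unit_index_in_basis)
  qed
  show ?thesis by (rule that[OF N1]) (simp_all add: N_simps)
qed

end

section \<open>Torsion-freeness\<close>

lemma lookup_frag_extend_inj:
  assumes "inj_on g B" "Poly_Mapping.keys x \<subseteq> B" "e \<in> B"
  shows "Poly_Mapping.lookup (frag_extend (frag_of \<circ> g) x) (g e) = Poly_Mapping.lookup x e"
proof -
  have "Poly_Mapping.lookup (frag_extend (frag_of \<circ> g) x) (g e) =
      (\<Sum>i\<in>Poly_Mapping.keys x. if i = e then Poly_Mapping.lookup x i else 0)"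
    unfolding lookup_frag_extend using assms by (intro sum.cong) (auto simp: inj_on_eq_iff subset_iff)
  then show ?thesis by (simp add: in_keys_iff)
qed

text \<open>Each key contributes the square of a positive integer, so there is one key and its
  coefficient is 1.\<close>

lemma frag_of_if_sum_squares_eq_1:
  assumes "frag_nonneg x" and sq: "(\<Sum>c\<in>Poly_Mapping.keys x. (Poly_Mapping.lookup x c)\<^sup>2) = 1"
  obtains c where "x = frag_of c"
proof -
  have "Poly_Mapping.keys x \<noteq> {}" using sq by auto
  then obtain c where c: "c \<in> Poly_Mapping.keys x" by blast
  define r where "r = (\<Sum>e\<in>Poly_Mapping.keys x - {c}. (Poly_Mapping.lookup x e)\<^sup>2)"
  have sum: "(Poly_Mapping.lookup x c)\<^sup>2 + r = 1"
    using c sq by (simp add: r_def sum.remove)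
  have c1: "Poly_Mapping.lookup x c \<ge> 1"
    using c assms(1) by (metis frag_nonneg_def in_keys_iff int_one_le_iff_zero_less order_le_less)
  then have "(Poly_Mapping.lookup x c)\<^sup>2 \<ge> 1" by simp
  moreover have "r \<ge> 0" by (simp add: r_def sum_nonneg)
  ultimately have "r = 0" "(Poly_Mapping.lookup x c)\<^sup>2 = 1" using sum by auto
  then have "Poly_Mapping.lookup x c = 1" using c1 by (simp add: power2_eq_1_iff)
  moreover have "Poly_Mapping.lookup x e = 0" if "e \<noteq> c" for e
    using \<open>r = 0\<close> that by (cases "e \<in> Poly_Mapping.keys x")
      (auto simp: r_def in_keys_iff sum_nonneg_eq_0_iff)
  ultimately have "x = frag_of c" by (intro poly_mapping_eqI) auto
  then show ?thesis by (rule that)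
qed

text \<open>Torsion-freeness yields an abstract isomorphism onto the standard module. Here it
  becomes a labelling \<open>g\<close> of the module basis by the basis of \<open>R\<close>, in the
  opposite direction, with the action expressed by products in \<open>R\<close>.\<close>

lemma torsion_free_basis:
  fixes R :: "'i based_ring_data" and N :: "('i, 'j, 'n) based_module_data_scheme"
  assumes "torsion_free R" and N: "cofinite_based_module R N"
    and "module_basis N \<noteq> {}" "connected_module R N"
  obtains g where "bij_betw g (basis R) (module_basis N)"
    "\<And>a c. \<lbrakk>a \<in> basis R; c \<in> basis R\<rbrakk> \<Longrightarrow>
      frag_of a \<odot>\<^bsub>N\<^esub> frag_of (g c) = frag_extend (frag_of \<circ> g) (frag_of a \<otimes>\<^bsub>R\<^esub> frag_of c)"
proof -
  interpret N: cofinite_based_module R N by fact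
  have "carrier N \<noteq> {\<zero>\<^bsub>N\<^esub>}"
  proof -
    obtain b where "b \<in> module_basis N" using assms(3) by blast
    then have "frag_of b \<in> carrier N" by (rule N.module_frag_of_closed)
    then show ?thesis using N.module_zero_eq by auto
  qed
  then obtain f where f: "based_module_iso R N (standard_module R) f"
    using torsion_freeD[OF assms(1) N] assms(4) by (auto simp: isomorphic_modules_def)
  then have f_inj: "inj_on f (carrier N)" and f_img: "f ` carrier N = carrier R"
    and f_add: "\<And>x y. \<lbrakk>x \<in> carrier N; y \<in> carrier N\<rbrakk> \<Longrightarrow> f (x + y) = f x + f y"
    and f_smult: "\<And>r x. \<lbrakk>r \<in> carrier R; x \<in> carrier N\<rbrakk> \<Longrightarrow> f (r \<odot>\<^bsub>N\<^esub> x) = r \<otimes>\<^bsub>R\<^esub> f x"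
    and f_basis: "\<And>b. b \<in> module_basis N \<Longrightarrow> f (frag_of b) \<in> frag_of ` basis R"
    by (auto simp: based_module_iso_def bij_betw_def standard_module_def N.module_add_eq N.add_eq)
  have f_diff: "f (x - y) = f x - f y" if "x \<in> carrier N" "y \<in> carrier N" for x y
    using f_add[of "x - y" y] N.module_minus_closed[of x y] that by (simp add: algebra_simps)
  have "\<exists>h. \<forall>b\<in>module_basis N. h b \<in> basis R \<and> f (frag_of b) = frag_of (h b)"
    using f_basis by (intro bchoice) blast
  then obtain h where h: "\<And>b. b \<in> module_basis N \<Longrightarrow> h b \<in> basis R \<and> f (frag_of b) = frag_of (h b)"
    by blast
  have f_h: "f x = frag_extend (frag_of \<circ> h) x" if "x \<in> carrier N" for x
  proof -
    have "Poly_Mapping.keys x \<subseteq> module_basis N" using that by (simp add: N.module_carrier_iff)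
    then have "x \<in> carrier N \<and> f x = frag_extend (frag_of \<circ> h) x"
    proof (induction rule: frag_induction)
      case zero
      have "0 \<in> carrier N" by (simp add: N.module_carrier_iff)
      then show ?case using f_diff[of 0 0] by simp
    next
      case (one b)
      then show ?case using h by (simp add: N.module_frag_of_closed)
    next
      case (diff x y)
      then show ?case by (simp add: f_diff frag_extend_diff N.module_minus_closed)
    qed
    then show ?thesis by simp
  qed
  have "inj_on h (module_basis N)"
  proof (rule inj_onI)
    fix b c assume "b \<in> module_basis N" "c \<in> module_basis N" "h b = h c"
    then have "f (frag_of b) = f (frag_of c)" using h by simp
    then have "frag_of b = frag_of c"
      using f_inj \<open>b \<in> _\<close> \<open>c \<in> _\<close> by (meson inj_onD N.module_frag_of_closed)
    then show "b = c" by (simp add: frag_of_eq)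
  qed
  \<comment> \<open>Basis elements are only known to map to basis elements. That all are hit follows
    from surjectivity of \<open>f\<close>: a preimage of \<open>frag_of c\<close> must involve a
    basis element with label \<open>c\<close>.\<close>
  moreover have "c \<in> h ` module_basis N" if c: "c \<in> basis R" for c
  proof -
    obtain x where x: "x \<in> carrier N" "frag_of c = f x"
      using f_img N.frag_of_closed[OF c] by blast
    then have "c \<in> Poly_Mapping.keys (frag_extend (frag_of \<circ> h) x)"
      using f_h by (metis keys_frag_of singletonI)
    then show ?thesis
      using keys_frag_extend[of "frag_of \<circ> h" x] x(1) by (auto simp: N.module_carrier_iff)
  qed
  ultimately have bij: "bij_betw h (module_basis N) (basis R)"
    using h by (auto simp: bij_betw_def)
  define g where "g = inv_into (module_basis N) h"
  have g: "bij_betw g (basis R) (module_basis N)"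
    unfolding g_def by (rule bij_betw_inv_into[OF bij])
  have hg: "h (g c) = c" if "c \<in> basis R" for c
    unfolding g_def by (rule bij_betw_inv_into_right[OF bij that])
  have gN: "g c \<in> module_basis N" if "c \<in> basis R" for c
    using g that by (auto simp: bij_betw_def)
  show ?thesis
  proof (rule that[OF g])
    fix a c assume ac: "a \<in> basis R" "c \<in> basis R"
    let ?x = "frag_of a \<otimes>\<^bsub>R\<^esub> frag_of c"
    have x: "Poly_Mapping.keys ?x \<subseteq> basis R"
      using ac N.m_closed[OF N.frag_of_closed N.frag_of_closed] by (simp add: N.carrier_iff)
    have xN: "frag_extend (frag_of \<circ> g) ?x \<in> carrier N"
      using x keys_frag_extend[of "frag_of \<circ> g" ?x] gN by (auto simp: N.module_carrier_iff)
    have "f (frag_extend (frag_of \<circ> g) ?x) = frag_extend frag_of ?x"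
      unfolding f_h[OF xN] frag_extend_frag_extend using x hg by (intro frag_extend_eq) auto
    also have "\<dots> = f (frag_of a \<odot>\<^bsub>N\<^esub> frag_of (g c))"
      using ac h[OF gN] hg by (simp add: frag_extend_frag_of_id f_smult N.frag_of_closed N.module_frag_of_closed gN)
    finally show "frag_of a \<odot>\<^bsub>N\<^esub> frag_of (g c) = frag_extend (frag_of \<circ> g) ?x"
      using f_inj xN N.smult_basis_closed[OF ac(1) gN[OF ac(2)]] by (metis inj_onD)
  qed
qed

text \<open>The set \<open>B\<close> of all constituents of products of elements \<open>j a\<close>
  with \<open>b\<close> carries a connected module over \<open>R\<close>, to which torsion-freeness
  applies.\<close>

lemma torsion_free_component:
  fixes R :: "'i based_ring_data" and M :: "('k, 'j, 'l) based_module_data_scheme"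
  assumes tf: "torsion_free R" and emb: "based_ring_embedding R Q j"
    and M: "cofinite_based_module Q M" and b: "b \<in> module_basis M"
  obtains g where "inj_on g (basis R)" "g ` basis R \<subseteq> module_basis M" "b \<in> g ` basis R"
    "\<And>a c. \<lbrakk>a \<in> basis R; c \<in> basis R\<rbrakk> \<Longrightarrow>
      frag_of (j a) \<odot>\<^bsub>M\<^esub> frag_of (g c) = frag_extend (frag_of \<circ> g) (frag_of a \<otimes>\<^bsub>R\<^esub> frag_of c)"
proof -
  interpret E: based_ring_embedding R Q j by fact
  interpret M: cofinite_based_module Q M by fact
  define B where "B = {c. \<exists>a\<in>basis R. M.occurs (j a) b c}"
  have BM: "B \<subseteq> module_basis M"
    using b M.occurs_in_basis E.j_in_basis by (auto simp: B_def)
  have bB: "b \<in> B"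
    unfolding B_def using M.occurs_unit_index[OF b, of b] E.j_unit E.R.unit_index_in_basis by force
  \<comment> \<open>Transitivity: the constituents of \<open>j a \<otimes> j a'\<close> are again in
    the image of \<open>j\<close>.\<close>
  have step: "\<exists>e\<in>basis R. M.occurs (j e) x z"
    if a: "a \<in> basis R" "a' \<in> basis R" and x: "x \<in> module_basis M" "M.occurs (j a') x y" "M.occurs (j a) y z"
    for a a' x y z
  proof -
    obtain u where u: "Poly_Mapping.lookup (frag_of (j a) \<otimes>\<^bsub>Q\<^esub> frag_of (j a')) u \<noteq> 0" "M.occurs u x z"
      using M.occurs_mult[of "j a" "j a'" x z] a x E.j_in_basis by blast
    then have "u \<in> Poly_Mapping.keys (frag_extend (frag_of \<circ> j) (frag_of a \<otimes>\<^bsub>R\<^esub> frag_of a'))"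
      using a by (simp add: E.j_mult in_keys_iff)
    moreover have "frag_of a \<otimes>\<^bsub>R\<^esub> frag_of a' \<in> carrier R" using a by (simp add: E.R.frag_of_closed)
    ultimately obtain e where "e \<in> basis R" "u = j e"
      using keys_frag_extend[of "frag_of \<circ> j" "frag_of a \<otimes>\<^bsub>R\<^esub> frag_of a'"]
      by (fastforce simp: E.R.carrier_iff)
    then show ?thesis using u(2) by blast
  qed
  have closed: "Poly_Mapping.keys (frag_of (j a) \<odot>\<^bsub>M\<^esub> frag_of c) \<subseteq> B" if "a \<in> basis R" "c \<in> B" for a c
    using step[OF that(1) _ b] that(2) by (auto simp: B_def M.occurs_def in_keys_iff)
  obtain N :: "('i, 'j) based_module_data" where N: "cofinite_based_module R N" "module_basis N = B"
    and smult: "\<And>a x. a \<odot>\<^bsub>N\<^esub> x = E.push a \<odot>\<^bsub>M\<^esub> x"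
    using E.restrict_module[OF M BM closed] by blast
  have "connected_module R N"
    unfolding connected_module_def
  proof (intro ballI)
    fix x y assume "x \<in> module_basis N" "y \<in> module_basis N"
    then obtain a a' where a: "a \<in> basis R" "M.occurs (j a) b x" "a' \<in> basis R" "M.occurs (j a') b y"
      and xy: "x \<in> B" "y \<in> B" by (auto simp: N(2) B_def)
    \<comment> \<open>From \<open>x\<close> the conjugate of \<open>a\<close> leads back to
      \<open>b\<close>, and \<open>a'\<close> leads on to \<open>y\<close>.\<close>
    have "M.occurs (j (conj_index R a)) x b"
      using M.occurs_conj[of "j a" b x] a xy BM b by (auto simp: E.j_conj E.j_in_basis)
    then obtain e where e: "e \<in> basis R" "M.occurs (j e) x y"
      using step[of a' "conj_index R a" x b y] a xy BM E.R.conj_index_in_basis by blast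
    have "module_const R N e x y = Poly_Mapping.lookup (frag_of e \<odot>\<^bsub>N\<^esub> frag_of x) y"
      using e xy by (intro cofinite_based_module.module_const_lookup[OF N(1)]) (auto simp: N(2))
    then show "\<exists>a\<in>basis R. module_const R N a x y \<noteq> 0"
      using e by (intro bexI[of _ e]) (auto simp: smult M.occurs_def)
  qed
  then obtain g where g: "bij_betw g (basis R) B"
    "\<And>a c. \<lbrakk>a \<in> basis R; c \<in> basis R\<rbrakk> \<Longrightarrow>
      frag_of a \<odot>\<^bsub>N\<^esub> frag_of (g c) = frag_extend (frag_of \<circ> g) (frag_of a \<otimes>\<^bsub>R\<^esub> frag_of c)"
    using torsion_free_basis[OF tf N(1)] bB unfolding N(2) by blast
  show ?thesis
    by (rule that[of g]) (use g BM bB in \<open>auto simp: bij_betw_def smult\<close>)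
qed

section \<open>Modules with a basis element of trivial stabilizer\<close>

context cofinite_based_module
begin

text \<open>The map sending \<open>x\<close> to \<open>x \<otimes> b\<close> is the inverse of the
  isomorphism. Triviality of the stabilizer makes each \<open>a \<otimes> b\<close> a single basis
  element \<open>h a\<close> and makes \<open>h\<close> injective; connectedness makes it
  surjective.\<close>

lemma isomorphic_standard_module:
  assumes con: "connected_module R M" and b: "b \<in> module_basis M"
    and trivial: "\<And>a. \<lbrakk>a \<in> basis R; occurs a b b\<rbrakk> \<Longrightarrow> a = unit_index R"
  shows "isomorphic_modules R M (standard_module R)"
proof -
  have bM: "frag_of b \<in> carrier M" using b by (rule module_frag_of_closed)
  have ex: "\<exists>c\<in>module_basis M. frag_of a \<odot>\<^bsub>M\<^esub> frag_of b = frag_of c" if a: "a \<in> basis R" for a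
  proof -
    let ?x = "frag_of a \<odot>\<^bsub>M\<^esub> frag_of b" and ?a = "conj_index R a"
    have a': "?a \<in> basis R" using a by (rule conj_index_in_basis)
    have x: "?x \<in> carrier M" using a b by (rule smult_basis_closed)
    have aa: "frag_of ?a \<otimes> frag_of a \<in> carrier R" using a a' by (simp add: frag_of_closed)
    \<comment> \<open>By reciprocity the multiplicity of \<open>b\<close> in the conjugate of
      \<open>a\<close> times \<open>c\<close> equals that of \<open>c\<close> in \<open>?x\<close>,
      so the squared norm of \<open>?x\<close> is one coefficient.\<close>
    have "(\<Sum>c\<in>Poly_Mapping.keys ?x. (Poly_Mapping.lookup ?x c)\<^sup>2) =
        Poly_Mapping.lookup (frag_of ?a \<odot>\<^bsub>M\<^esub> ?x) b"
      using x a b by (subst smult_expand_right)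
        (auto simp: frag_of_closed a' lookup_frag_extend power2_eq_square lookup_smult_conj
          module_carrier_iff subset_iff intro!: sum.cong)
    also have "frag_of ?a \<odot>\<^bsub>M\<^esub> ?x = (frag_of ?a \<otimes> frag_of a) \<odot>\<^bsub>M\<^esub> frag_of b"
      using a a' bM by (simp add: smult_assoc frag_of_closed)
    \<comment> \<open>Only the unit has \<open>b\<close> as a constituent of its product with
      \<open>b\<close>, so only the unit coefficient of the product of the conjugate of
      \<open>a\<close> with \<open>a\<close> survives, and that is 1.\<close>
    also have "Poly_Mapping.lookup \<dots> b =
        (\<Sum>e\<in>Poly_Mapping.keys (frag_of ?a \<otimes> frag_of a).
          if e = unit_index R then Poly_Mapping.lookup (frag_of ?a \<otimes> frag_of a) e else 0)"
    proof (subst smult_expand_left[OF aa bM], unfold lookup_frag_extend, intro sum.cong refl)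
      fix e assume "e \<in> Poly_Mapping.keys (frag_of ?a \<otimes> frag_of a)"
      then have e: "e \<in> basis R" using aa by (auto simp: carrier_iff)
      have one: "frag_of (unit_index R) \<odot>\<^bsub>M\<^esub> frag_of b = frag_of b"
        using smult_one[OF bM] by (simp add: one_eq)
      show "Poly_Mapping.lookup (frag_of ?a \<otimes> frag_of a) e * Poly_Mapping.lookup (frag_of e \<odot>\<^bsub>M\<^esub> frag_of b) b =
          (if e = unit_index R then Poly_Mapping.lookup (frag_of ?a \<otimes> frag_of a) e else 0)"
      proof (cases "e = unit_index R")
        case True
        then show ?thesis by (simp add: one)
      next
        case False
        then have "\<not> occurs e b b" using trivial[OF e] by blast
        then show ?thesis using False by (simp add: occurs_def)
      qed
    qed
    also have "\<dots> = 1"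
      using lookup_mult_unit_index[OF a' a] a by (simp add: in_keys_iff conj_index_conj_index)
    finally obtain c where c: "?x = frag_of c"
      using frag_of_if_sum_squares_eq_1 frag_nonneg_smult[OF a b] by blast
    then show ?thesis using x by (auto simp: module_carrier_iff)
  qed
  then obtain h where h: "\<And>a. a \<in> basis R \<Longrightarrow> h a \<in> module_basis M \<and> frag_of a \<odot>\<^bsub>M\<^esub> frag_of b = frag_of (h a)"
    by metis
  have occ: "occurs a b c \<longleftrightarrow> c = h a" if "a \<in> basis R" for a c
    using h[OF that] by (simp add: occurs_def)
  have inj: "inj_on h (basis R)"
  proof (rule inj_onI)
    fix a a' assume a: "a \<in> basis R" "a' \<in> basis R" "h a = h a'"
    then have "occurs a' b (h a)" "occurs a b (h a)" by (simp_all add: occ)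
    \<comment> \<open>Going to \<open>h a\<close> by \<open>a'\<close> and back by the conjugate of
      \<open>a\<close> stabilizes \<open>b\<close>. Hence that product contains the unit, which
      forces \<open>a' = a\<close>.\<close>
    then have "occurs (conj_index R a) (h a) b" using h[OF a(1)] a b by (simp add: occurs_conj)
    then obtain e where e: "Poly_Mapping.lookup (frag_of (conj_index R a) \<otimes> frag_of a') e \<noteq> 0" "occurs e b b"
      using occurs_mult[of "conj_index R a" a' b b] a b \<open>occurs a' b (h a)\<close> conj_index_in_basis by blast
    have "frag_of (conj_index R a) \<otimes> frag_of a' \<in> carrier R"
      using a by (simp add: frag_of_closed conj_index_in_basis)
    then have "e = unit_index R" using e by (intro trivial) (auto simp: carrier_iff in_keys_iff)
    then show "a = a'"
      using e(1) a by (auto simp: lookup_mult_unit_index conj_index_in_basis conj_index_conj_index split: if_splits)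
  qed
  have surj: "h ` basis R = module_basis M"
  proof
    show "h ` basis R \<subseteq> module_basis M" using h by blast
    show "module_basis M \<subseteq> h ` basis R"
    proof
      fix c assume c: "c \<in> module_basis M"
      then obtain a where "a \<in> basis R" "module_const R M a b c \<noteq> 0"
        using con b unfolding connected_module_def by blast
      then show "c \<in> h ` basis R"
        using module_const_lookup[of a b c] b c occ[of a c] by (auto simp: occurs_def)
    qed
  qed
  define F where "F = frag_extend (frag_of \<circ> h)"
  define G where "G = frag_extend (frag_of \<circ> inv_into (basis R) h)"
  have F: "F x = x \<odot>\<^bsub>M\<^esub> frag_of b" if "x \<in> carrier R" for x
    using that bM h by (subst smult_expand_left) (auto simp: F_def carrier_iff subset_iff intro!: frag_extend_eq)
  have F_closed: "F x \<in> carrier M" if "x \<in> carrier R" for x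
    using that bM by (simp add: F smult_closed)
  have G_closed: "G y \<in> carrier R" if "y \<in> carrier M" for y
    unfolding G_def using that surj
    by (intro frag_extend_closed) (auto simp: module_carrier_iff subset_iff frag_of_closed inv_into_into)
  have GF: "G (F x) = x" if "x \<in> carrier R" for x
  proof -
    have "G (F x) = frag_extend frag_of x"
      unfolding G_def F_def frag_extend_frag_extend using that inj
      by (intro frag_extend_eq) (auto simp: carrier_iff subset_iff)
    then show ?thesis by (simp add: frag_extend_frag_of_id)
  qed
  have FG: "F (G y) = y" if "y \<in> carrier M" for y
  proof -
    have "F (G y) = frag_extend frag_of y"
      unfolding G_def F_def frag_extend_frag_extend using that surj
      by (intro frag_extend_eq) (auto simp: module_carrier_iff subset_iff f_inv_into_f)
    then show ?thesis by (simp add: frag_extend_frag_of_id)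
  qed
  have "based_module_iso R M (standard_module R) G"
    unfolding based_module_iso_def
  proof (intro conjI ballI)
    show "bij_betw G (carrier M) (carrier (standard_module R))"
      by (rule bij_betwI[of _ _ _ F]) (auto simp: standard_module_def GF FG F_closed G_closed)
    show "G (x \<oplus>\<^bsub>M\<^esub> y) = G x \<oplus>\<^bsub>standard_module R\<^esub> G y" for x y
      by (simp add: G_def standard_module_def module_add_eq add_eq frag_extend_add)
    show "G (r \<odot>\<^bsub>M\<^esub> x) = r \<odot>\<^bsub>standard_module R\<^esub> G x" if "r \<in> carrier R" "x \<in> carrier M" for r x
    proof -
      \<comment> \<open>Linearity is immediate for \<open>F\<close>, where it is associativity of
        the action, and passes to the inverse \<open>G\<close>.\<close>
      have "F (r \<otimes> G x) = r \<odot>\<^bsub>M\<^esub> x"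
        using that G_closed[OF that(2)] bM FG[OF that(2)] by (simp add: F smult_assoc)
      then show ?thesis using GF[of "r \<otimes> G x"] that G_closed by (simp add: standard_module_def)
    qed
    show "G (frag_of c) \<in> frag_of ` module_basis (standard_module R)" if "c \<in> module_basis M" for c
      using that surj by (auto simp: G_def standard_module_def inv_into_into)
  qed
  then show ?thesis by (auto simp: isomorphic_modules_def)
qed

end

text \<open>A_s sits in the free product as the empty word and the one-letter words;
  multiplicativity is \<open>word_mult_prepend\<close> with empty rest.\<close>

lemma (in based_ring_family) based_ring_embedding_letters:
  assumes "s \<in> S"
  shows "based_ring_embedding (A s) fp (prepend s [])"
proof -
  interpret R: based_ring "A s" using assms by (rule based_ring_A)
  show ?thesis
  proof (intro based_ring_embedding.intro based_ring_embedding_axioms.intro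
      R.based_ring_axioms based_ring_free_product)
    show "frag_extend (frag_of \<circ> prepend s []) (frag_of a \<otimes>\<^bsub>A s\<^esub> frag_of b) =
        frag_of (prepend s [] a) \<otimes>\<^bsub>fp\<^esub> frag_of (prepend s [] b)"
      if "a \<in> basis (A s)" "b \<in> basis (A s)" for a b
      using that assms by (simp add: free_product_simps word_mult_prepend)
    show "inj_on (prepend s []) (basis (A s))" by (auto simp: inj_on_def prepend_def)
  qed (auto simp: free_product_simps assms alternating_words_Nil prepend_in_words prepend_def
        word_conj_simps conj_index_eq_unit_iff alternating_words_Cons)
qed

section \<open>Descent on the dimension of the form\<close>

locale free_product_module = fusion_ring_family S A d + M: cofinite_based_module "free_product S A" M
  for S :: "'s set" and A :: "'s \<Rightarrow> 'i based_ring_data" and d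
    and M :: "(('s \<times> 'i) list, 'j, 'n) based_module_data_scheme" +
  assumes torsion_free_A: "s \<in> S \<Longrightarrow> torsion_free (A s)"
begin

abbreviation J :: "'j set" where "J \<equiv> module_basis M"

definition form_dim :: "'j \<Rightarrow> real"
  where "form_dim b = fp_dim (form M (frag_of b) (frag_of b))"

lemma form_dim_ge_1: "b \<in> J \<Longrightarrow> 1 \<le> form_dim b"
proof -
  assume b: "b \<in> J"
  then have "[] \<in> Poly_Mapping.keys (form M (frag_of b) (frag_of b))"
    using M.tau_form[OF b b] by (simp add: tau_def free_product_simps in_keys_iff)
  then have "(\<Sum>u\<in>{[]}. fp_dim (frag_of u)) \<le> form_dim b"
    unfolding form_dim_def using b
    by (intro fp.sum_le_dimension_function[OF dimension_function_free_product])
       (auto simp: M.form_closed M.module_frag_of_closed M.frag_nonneg_form)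
  then show ?thesis by (simp add: fp_dim_def word_dim_simps)
qed

text \<open>All that is needed of the A_s-component of \<open>b\<close>. The last clause holds
  because \<open>g c\<close> is the one-letter word \<open>c\<close> applied to \<open>g\<close> of
  the unit, so \<open>form_diag_smult\<close> gives the factor twice.\<close>

lemma component:
  assumes s: "s \<in> S" and b: "b \<in> J"
  obtains g where "g ` basis (A s) \<subseteq> J" "b \<in> g ` basis (A s)"
    "\<And>a c e. \<lbrakk>a \<in> basis (A s); c \<in> basis (A s); e \<in> basis (A s)\<rbrakk> \<Longrightarrow>
      M.occurs (prepend s [] a) (g c) (g e) \<longleftrightarrow> Poly_Mapping.lookup (frag_of a \<otimes>\<^bsub>A s\<^esub> frag_of c) e \<noteq> 0"
    "\<And>a c x. \<lbrakk>a \<in> basis (A s); c \<in> basis (A s); M.occurs (prepend s [] a) (g c) x\<rbrakk> \<Longrightarrow> x \<in> g ` basis (A s)"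
    "\<And>c. c \<in> basis (A s) \<Longrightarrow> form_dim (g c) = (d s (frag_of c))\<^sup>2 * form_dim (g (unit_index (A s)))"
proof -
  interpret R: based_ring "A s" using s by (rule based_ring_A)
  obtain g where g: "inj_on g (basis (A s))" "g ` basis (A s) \<subseteq> J" "b \<in> g ` basis (A s)"
    and smult: "\<And>a c. \<lbrakk>a \<in> basis (A s); c \<in> basis (A s)\<rbrakk> \<Longrightarrow>
      frag_of (prepend s [] a) \<odot>\<^bsub>M\<^esub> frag_of (g c) = frag_extend (frag_of \<circ> g) (frag_of a \<otimes>\<^bsub>A s\<^esub> frag_of c)"
    using torsion_free_component[OF torsion_free_A[OF s] based_ring_embedding_letters[OF s]
        M.cofinite_based_module_axioms b] by blast
  have keys: "Poly_Mapping.keys (frag_of a \<otimes>\<^bsub>A s\<^esub> frag_of c) \<subseteq> basis (A s)"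
    if "a \<in> basis (A s)" "c \<in> basis (A s)" for a c
    using R.m_closed[OF R.frag_of_closed[OF that(1)] R.frag_of_closed[OF that(2)]] by (simp add: R.carrier_iff)
  show ?thesis
  proof (rule that[OF g(2,3)])
    show "M.occurs (prepend s [] a) (g c) (g e) \<longleftrightarrow> Poly_Mapping.lookup (frag_of a \<otimes>\<^bsub>A s\<^esub> frag_of c) e \<noteq> 0"
      if "a \<in> basis (A s)" "c \<in> basis (A s)" "e \<in> basis (A s)" for a c e
      using that keys by (simp add: M.occurs_def smult lookup_frag_extend_inj[OF g(1)])
    show "x \<in> g ` basis (A s)"
      if "a \<in> basis (A s)" "c \<in> basis (A s)" "M.occurs (prepend s [] a) (g c) x" for a c x
    proof -
      have "x \<in> Poly_Mapping.keys (frag_extend (frag_of \<circ> g) (frag_of a \<otimes>\<^bsub>A s\<^esub> frag_of c))"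
        using that by (simp add: M.occurs_def smult in_keys_iff)
      then show ?thesis
        using keys_frag_extend[of "frag_of \<circ> g" "frag_of a \<otimes>\<^bsub>A s\<^esub> frag_of c"] keys[OF that(1,2)] by auto
    qed
    show "form_dim (g c) = (d s (frag_of c))\<^sup>2 * form_dim (g (unit_index (A s)))" if c: "c \<in> basis (A s)" for c
    proof -
      let ?e = "g (unit_index (A s))" and ?c = "frag_of (prepend s [] c)"
      have J: "?e \<in> J" "g c \<in> J" using g(2) c R.unit_index_in_basis by auto
      have "prepend s [] c \<in> basis fp"
        using c s by (simp add: free_product_simps prepend_in_words alternating_words_Nil)
      moreover have "frag_of c \<otimes>\<^bsub>A s\<^esub> frag_of (unit_index (A s)) = frag_of c"
        using R.r_one[OF R.frag_of_closed[OF c]] by (simp add: R.one_eq)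
      ultimately have "form M (frag_of (g c)) (frag_of (g c)) =
          ?c \<otimes>\<^bsub>fp\<^esub> bar fp (?c \<otimes>\<^bsub>fp\<^esub> form M (frag_of ?e) (frag_of ?e))"
        using J c smult[of c "unit_index (A s)"] R.unit_index_in_basis
        by (intro M.form_diag_smult) auto
      moreover have "?c \<in> carrier fp" "form M (frag_of ?e) (frag_of ?e) \<in> carrier fp"
        using \<open>prepend s [] c \<in> basis fp\<close> J by (auto simp: fp.frag_of_closed M.form_closed M.module_frag_of_closed)
      moreover have "fp_dim ?c = d s (frag_of c)"
        using R.dimension_function_one[OF dimension_function_A[OF s]]
        by (simp add: fp_dim_def prepend_def word_dim_simps)
      ultimately show ?thesis
        by (simp add: form_dim_def fp.dimension_function_mult[OF dimension_function_free_product]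
            fp.dimension_function_bar[OF dimension_function_free_product] fp.bar_closed power2_eq_square)
    qed
  qed
qed

text \<open>All powers of \<open>w\<close> would occur in the finitely supported element \<open>\<langle>b, b\<rangle>\<close>.\<close>

lemma cyclically_reduced_not_occurs:
  assumes w: "w @ w \<in> W" "w \<noteq> []" and b: "b \<in> J" and occ: "M.occurs w b b"
  shows False
proof -
  define p where "p n = concat (replicate n w)" for n
  have wW: "w \<in> W" and lh: "fst (last w) \<noteq> fst (hd w)"
    using w by (auto simp: alternating_words_append)
  have hd_p: "p n = [] \<or> hd (p n) = hd w" for n
    using w(2) by (cases n) (auto simp: p_def)
  have p: "p n \<in> W \<and> M.occurs (p n) b b" for n
  proof (induction n)
    case 0
    then show ?case
      using M.occurs_unit_index[OF b] by (simp add: p_def alternating_words_Nil free_product_simps)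
  next
    case (Suc n)
    have Suc_p: "p (Suc n) = w @ p n" by (simp add: p_def)
    \<comment> \<open>The last and first letters of \<open>w\<close> have different indices, so
      nothing cancels and the power is one word.\<close>
    have "word_mult A w (p n) = frag_of (p (Suc n))"
      unfolding Suc_p using hd_p[of n] lh by (intro word_mult_concat) auto
    then have "frag_of w \<otimes>\<^bsub>fp\<^esub> frag_of (p n) = frag_of (p (Suc n))" by (simp add: free_product_simps)
    moreover obtain e where "Poly_Mapping.lookup (frag_of w \<otimes>\<^bsub>fp\<^esub> frag_of (p n)) e \<noteq> 0" "M.occurs e b b"
      using M.occurs_mult[of w "p n" b b] Suc wW occ b by (auto simp: free_product_simps(1))
    ultimately have "M.occurs (p (Suc n)) b b" by (auto split: if_splits)
    moreover have "p (Suc n) \<in> W"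
      using Suc wW hd_p[of n] lh by (auto simp: Suc_p alternating_words_append)
    ultimately show ?case by simp
  qed
  have "range (\<lambda>n. word_conj A (p n)) \<subseteq> Poly_Mapping.keys (form M (frag_of b) (frag_of b))"
    using p M.lookup_form[of "p _" b b] b by (auto simp: in_keys_iff M.occurs_def free_product_simps(1,3))
  then have "finite (range (\<lambda>n. word_conj A (p n)))" by (rule finite_subset) simp
  moreover have "inj (\<lambda>n. word_conj A (p n))"
  proof (rule injI)
    fix m n assume "word_conj A (p m) = word_conj A (p n)"
    then have "length (word_conj A (p m)) = length (word_conj A (p n))" by simp
    then show "m = n" using w(2) by (simp add: word_conj_def p_def length_concat sum_list_replicate)
  qed
  ultimately show False using finite_imageD infinite_UNIV_nat by blast
qed

lemma occurs_halve_form_dim: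
  assumes "b \<in> J" "w \<in> W" "w \<noteq> []" "M.occurs w b b"
  shows "\<exists>c\<in>J. 2 * form_dim c \<le> form_dim b"
  using assms
proof (induction "length w" arbitrary: b w rule: less_induct)
  case less
  obtain s a v where w: "w = (s, a) # v" using less.prems(3) by (metis list.exhaust surj_pair)
  have s: "s \<in> S" "a \<in> basis (A s)" "a \<noteq> unit_index (A s)" "v \<in> W" "v = [] \<or> fst (hd v) \<noteq> s"
    using less.prems(2) by (auto simp: w alternating_words_Cons)
  interpret R: based_ring "A s" using s(1) by (rule based_ring_A)
  note ds = dimension_function_A[OF s(1)]
  obtain g where gJ: "g ` basis (A s) \<subseteq> J" and b: "b \<in> g ` basis (A s)"
    and g_occ: "\<And>a c e. \<lbrakk>a \<in> basis (A s); c \<in> basis (A s); e \<in> basis (A s)\<rbrakk> \<Longrightarrow>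
      M.occurs (prepend s [] a) (g c) (g e) \<longleftrightarrow> Poly_Mapping.lookup (frag_of a \<otimes>\<^bsub>A s\<^esub> frag_of c) e \<noteq> 0"
    and g_closed: "\<And>a c x. \<lbrakk>a \<in> basis (A s); c \<in> basis (A s); M.occurs (prepend s [] a) (g c) x\<rbrakk> \<Longrightarrow> x \<in> g ` basis (A s)"
    and g_dim: "\<And>c. c \<in> basis (A s) \<Longrightarrow> form_dim (g c) = (d s (frag_of c))\<^sup>2 * form_dim (g (unit_index (A s)))"
    using component[OF s(1) less.prems(1)] by blast
  obtain m where m: "m \<in> basis (A s)" "b = g m" using b by blast
  have g1: "g (unit_index (A s)) \<in> J" using gJ R.unit_index_in_basis by blast
  have neq: "conj_index (A s) x \<noteq> unit_index (A s)" if "x \<in> basis (A s)" "x \<noteq> unit_index (A s)" for x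
    using that s(1) by (simp add: conj_index_eq_unit_iff)
  show ?case
  proof (cases "v = []")
    case True
    then have "w = prepend s [] a" using s(3) by (simp add: w prepend_def)
    \<comment> \<open>A single letter \<open>a\<close> stabilizing \<open>b = g m\<close> puts its
      conjugate, which is not the unit, into \<open>m\<close> times the conjugate of
      \<open>m\<close>.\<close>
    then have "Poly_Mapping.lookup (frag_of a \<otimes>\<^bsub>A s\<^esub> frag_of m) m \<noteq> 0"
      using less.prems(4) m s by (simp add: g_occ)
    then have "2 \<le> (d s (frag_of m))\<^sup>2"
      using R.lookup_mult_bar_iff[OF s(2) m(1)] neq[OF s(2,3)]
        R.dimension_function_square_ge_2[OF ds m(1)] by blast
    then have "2 * form_dim (g (unit_index (A s))) \<le> form_dim b"
      unfolding m(2) g_dim[OF m(1)] using form_dim_ge_1[OF g1] by (intro mult_right_mono) auto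
    then show ?thesis using g1 by blast
  next
    case False
    then obtain u t c where v: "v = u @ [(t, c)]" by (metis rev_exhaust surj_pair)
    have c: "c \<in> basis (A t)" "c \<noteq> unit_index (A t)" "u \<in> W" "u = [] \<or> fst (last u) \<noteq> t"
      using s(4) by (auto simp: v alternating_words_append alternating_words_Cons)
    have "s = t"
    proof (rule ccontr)
      assume "s \<noteq> t"
      then have "w @ w \<in> W" unfolding alternating_words_append using less.prems(2) by (simp add: w v)
      then show False using cyclically_reduced_not_occurs less.prems by blast
    qed
    \<comment> \<open>If \<open>u\<close> were empty, the letters \<open>a\<close> and
      \<open>c\<close>, now both from A_s, would be adjacent in \<open>w\<close>.\<close>
    then have u: "u \<noteq> []" "fst (hd u) \<noteq> s" "fst (last u) \<noteq> s"
      using s(5) c(4) by (auto simp: v hd_append split: if_splits)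
    \<comment> \<open>Such a word starts in I_s and ends outside it, so it is cyclically
      reduced.\<close>
    have cyc: "\<not> M.occurs ((s, x) # u) y y" if "x \<in> basis (A s)" "x \<noteq> unit_index (A s)" "y \<in> J" for x y
    proof -
      have "(s, x) # u \<in> W" using that s(1) c(3) u by (simp add: alternating_words_Cons)
      then have "((s, x) # u) @ ((s, x) # u) \<in> W" unfolding alternating_words_append using u by simp
      then show ?thesis using cyclically_reduced_not_occurs that(3) by blast
    qed
    have au: "(s, a) # u \<in> W" "[(s, c)] \<in> W"
      using s c u \<open>s = t\<close> by (auto simp: alternating_words_Cons alternating_words_Nil)
    have "word_mult A ((s, a) # u) [(s, c)] = frag_of w"
      using u word_mult_concat[of "(s, a) # u" "[(s, c)]"] by (simp add: w v \<open>s = t\<close>)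
    then have "\<exists>e. Poly_Mapping.lookup (frag_of ((s, a) # u) \<otimes>\<^bsub>fp\<^esub> frag_of [(s, c)]) e \<noteq> 0 \<and> M.occurs e b b"
      using less.prems(4) by (intro exI[of _ w]) (simp add: free_product_simps)
    \<comment> \<open>Splitting \<open>w\<close> as \<open>(s, a) # u\<close> times \<open>c\<close>
      gives an intermediate element \<open>y\<close>. Starting the loop at \<open>y\<close> instead
      of \<open>b\<close> rotates the product to \<open>c\<close> times \<open>(s, a) # u\<close>,
      where \<open>c\<close> and \<open>a\<close> meet.\<close>
    then obtain y where y: "M.occurs [(s, c)] b y" "M.occurs ((s, a) # u) y b"
      using M.occurs_mult[of "(s, a) # u" "[(s, c)]" b b] au less.prems(1)
      by (auto simp: free_product_simps(1))
    have yJ: "y \<in> J" using M.occurs_in_basis[OF y(1)] au less.prems(1) by (simp add: free_product_simps(1))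
    obtain x where x: "Poly_Mapping.lookup (frag_of [(s, c)] \<otimes>\<^bsub>fp\<^esub> frag_of ((s, a) # u)) x \<noteq> 0" "M.occurs x y y"
      using M.occurs_mult[of "[(s, c)]" "(s, a) # u" y y] au yJ y by (auto simp: free_product_simps(1))
    have "frag_of [(s, c)] \<otimes>\<^bsub>fp\<^esub> frag_of ((s, a) # u) =
        frag_extend (frag_of \<circ> prepend s u) (frag_of c \<otimes>\<^bsub>A s\<^esub> frag_of a)"
      using word_mult_prepend[of s c a u] s c u \<open>s = t\<close> by (simp add: free_product_simps prepend_def)
    then have "x \<in> Poly_Mapping.keys (frag_extend (frag_of \<circ> prepend s u) (frag_of c \<otimes>\<^bsub>A s\<^esub> frag_of a))"
      using x(1) by (simp add: in_keys_iff)
    then obtain e where e: "e \<in> Poly_Mapping.keys (frag_of c \<otimes>\<^bsub>A s\<^esub> frag_of a)" "x = prepend s u e"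
      using keys_frag_extend[of "frag_of \<circ> prepend s u" "frag_of c \<otimes>\<^bsub>A s\<^esub> frag_of a"] by auto
    have cs: "c \<in> basis (A s)" using c \<open>s = t\<close> by simp
    have "frag_of c \<otimes>\<^bsub>A s\<^esub> frag_of a \<in> carrier (A s)"
      using s(2) cs by (simp add: R.frag_of_closed)
    then have "e \<in> basis (A s)" using e(1) by (auto simp: R.carrier_iff)
    \<comment> \<open>A non-unit summand \<open>e\<close> of \<open>c \<otimes> a\<close> would give
      the word \<open>(s, e) # u\<close>, excluded by \<open>cyc\<close>; so \<open>c\<close> and
      \<open>a\<close> cancel and \<open>u\<close> alone stabilizes \<open>y\<close>.\<close>
    then have "e = unit_index (A s)" using cyc[of e y] x(2) yJ e(2) by (auto simp: prepend_def split: if_splits)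
    then have uy: "M.occurs u y y" using x(2) e(2) by (simp add: prepend_def)
    have "[(s, c)] = prepend s [] c" using c \<open>s = t\<close> by (simp add: prepend_def)
    then obtain n where n: "n \<in> basis (A s)" "y = g n"
      using g_closed[of c m y] y(1) m c \<open>s = t\<close> by auto
    \<comment> \<open>Otherwise some letter \<open>z\<close> of A_s stabilizes \<open>y\<close>.
      Combined with \<open>u\<close> this gives the stabilizing word \<open>(s, z) # u\<close>,
      again excluded by \<open>cyc\<close>.\<close>
    have "Poly_Mapping.keys (frag_of n \<otimes>\<^bsub>A s\<^esub> bar (A s) (frag_of n)) \<subseteq> {unit_index (A s)}"
    proof (rule subsetI, rule ccontr)
      fix x' assume x': "x' \<in> Poly_Mapping.keys (frag_of n \<otimes>\<^bsub>A s\<^esub> bar (A s) (frag_of n))" "x' \<notin> {unit_index (A s)}"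
      have "frag_of n \<otimes>\<^bsub>A s\<^esub> bar (A s) (frag_of n) \<in> carrier (A s)"
        using n by (simp add: R.frag_of_closed R.bar_closed)
      then have x'': "x' \<in> basis (A s)" "x' \<noteq> unit_index (A s)" using x' by (auto simp: R.carrier_iff)
      define z where "z = conj_index (A s) x'"
      have z: "z \<in> basis (A s)" "z \<noteq> unit_index (A s)" "conj_index (A s) z = x'"
        using x'' neq by (auto simp: z_def R.conj_index_in_basis R.conj_index_conj_index)
      have "M.occurs (prepend s [] z) y y"
        using R.lookup_mult_bar_iff[OF z(1) n(1)] x' z n by (simp add: g_occ)
      then have "M.occurs [(s, z)] y y" using z by (simp add: prepend_def)
      moreover have "frag_of [(s, z)] \<otimes>\<^bsub>fp\<^esub> frag_of u = frag_of ((s, z) # u)"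
        using word_mult_concat[of "[(s, z)]" u] u by (simp add: free_product_simps)
      moreover have "[(s, z)] \<in> W" using z s by (simp add: alternating_words_Cons alternating_words_Nil)
      ultimately have "M.occurs ((s, z) # u) y y"
        using M.occurs_mult[of "[(s, z)]" u y y] uy c(3) yJ
        by (auto simp: free_product_simps(1) split: if_splits)
      then show False using cyc z yJ by blast
    qed
    \<comment> \<open>So \<open>n\<close> has dimension 1, and \<open>y\<close> takes the least
      value in the component. Passing from \<open>b\<close> to \<open>y\<close> therefore does not
      increase \<open>form_dim\<close>, and the induction hypothesis for \<open>u\<close> halves
      it.\<close>
    then have "form_dim y = form_dim (g (unit_index (A s)))"
      using R.dimension_function_invertible[OF ds n(1)] n g_dim by simp
    moreover have "1 * form_dim (g (unit_index (A s))) \<le> form_dim b"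
      unfolding m(2) g_dim[OF m(1)]
      using R.dimension_function_ge_1[OF ds m(1)] form_dim_ge_1[OF g1] by (intro mult_right_mono) auto
    moreover have "\<exists>c\<in>J. 2 * form_dim c \<le> form_dim y"
      using less.hyps[of u y] yJ c(3) u(1) uy by (simp add: w v)
    ultimately show ?thesis by force
  qed
qed

lemma ex_trivial_stabilizer:
  assumes "J \<noteq> {}"
  shows "\<exists>b\<in>J. \<forall>w\<in>W. M.occurs w b b \<longrightarrow> w = []"
proof (rule ccontr)
  assume "\<not> ?thesis"
  then have step: "\<exists>c\<in>J. 2 * form_dim c \<le> form_dim b" if "b \<in> J" for b
    using occurs_halve_form_dim that by blast
  obtain b where b: "b \<in> J" using assms by blast
  have descent: "\<exists>c\<in>J. 2 ^ n * form_dim c \<le> form_dim b" for n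
  proof (induction n)
    case 0
    then show ?case using b by auto
  next
    case (Suc n)
    then obtain c where c: "c \<in> J" "2 ^ n * form_dim c \<le> form_dim b" by blast
    then obtain e where e: "e \<in> J" "2 * form_dim e \<le> form_dim c" using step by blast
    have "2 ^ Suc n * form_dim e = 2 ^ n * (2 * form_dim e)" by simp
    also have "\<dots> \<le> 2 ^ n * form_dim c" using e by (intro mult_left_mono) auto
    also have "\<dots> \<le> form_dim b" by (rule c)
    finally show ?case using e by blast
  qed
  have "2 ^ n \<le> form_dim b" for n
  proof -
    obtain c where c: "c \<in> J" "2 ^ n * form_dim c \<le> form_dim b"
      using descent by blast
    have "2 ^ n * 1 \<le> 2 ^ n * form_dim c" using form_dim_ge_1[OF c(1)] by (intro mult_left_mono) auto
    then show ?thesis using c(2) by linarith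
  qed
  moreover obtain n where "form_dim b < 2 ^ n" using real_arch_pow[of 2 "form_dim b"] by auto
  ultimately show False by (simp add: leD)
qed

lemma isomorphic_to_standard:
  assumes "carrier M \<noteq> {\<zero>\<^bsub>M\<^esub>}" "connected_module fp M"
  shows "isomorphic_modules fp M (standard_module fp)"
proof -
  have "J \<noteq> {}"
    using assms(1) by (auto simp: M.module_carrier_eq free_Abelian_group_def M.module_zero_eq)
  then obtain b where "b \<in> J" "\<forall>w\<in>W. M.occurs w b b \<longrightarrow> w = []"
    using ex_trivial_stabilizer by blast
  then show ?thesis
    using assms(2) by (intro M.isomorphic_standard_module) (auto simp: free_product_simps)
qed

end

theorem theorem1p25:
  fixes S :: "'s set" and A :: "'s \<Rightarrow> 'i based_ring_data"
  assumes "\<And>s. s \<in> S \<Longrightarrow> fusion_ring (A s)"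
    and "\<And>s. s \<in> S \<Longrightarrow> torsion_free (A s)"
  shows "fusion_ring (free_product S A) \<and> torsion_free (free_product S A)"
proof -
  have "\<forall>s\<in>S. \<exists>d. dimension_function (A s) d"
    using assms(1) fusion_ring.ex_dimension_function by blast
  \<comment> \<open>A dimension function is chosen for each \<open>s\<close>, since the one on the
    free product is built from these choices.\<close>
  then obtain d where d: "\<And>s. s \<in> S \<Longrightarrow> dimension_function (A s) (d s)"
    by (metis (no_types))
  interpret fusion_ring_family S A d
    using d assms(1) by (auto intro!: fusion_ring_family.intro fusion_ring.axioms(1))
  have "torsion_free (free_product S A)"
    unfolding torsion_free_def
  proof (intro allI impI, elim conjE)
    fix M :: "(('s \<times> 'i) list, ('s \<times> 'i) list \<times> nat) based_module_data"
    assume M: "cofinite_based_module (free_product S A) M" "carrier M \<noteq> {\<zero>\<^bsub>M\<^esub>}"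
      "connected_module (free_product S A) M"
    interpret free_product_module S A d M
      using assms(2) fusion_ring_family_axioms M(1)
      by (intro free_product_module.intro free_product_module_axioms.intro)
    show "isomorphic_modules (free_product S A) M (standard_module (free_product S A))"
      using M(2,3) by (rule isomorphic_to_standard)
  qed
  then show ?thesis using fusion_ring_free_product by blast
qed

end
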